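(* For all integers $k \geq 7$ and all $k' \in \omega$, the class $\mathcal{U}^k$ of $k$-universal graphs is not definable in $\bigvee L^{k'}(\exists)$ over the class of graphs; that is, there is no sentence $\varphi$ of $\bigvee L^{k'}(\exists)$ such that for every graph $G$: $G$ is $k$-universal if and only if $G \models \varphi$.
   Context: A graph is a finite structure with a single binary relation $E$ which is irreflexive and symmetric. The language is $\{E\}$ with equality. $L^k$ is the fragment of first-order logic consisting of the formulas all of whose variables, free and bound, are among $x_1,\ldots,x_k$. $L^k(\exists)$ is the collection of formulas obtained by closing the set of atomic formulas and negated atomic formulas of $L^k$ (equalities included) under conjunction, disjunction, and existential quantification. $\bigvee L^{k}(\exists)$ consists of the countable disjunctions of formulas of $L^k(\exists)$. For structures $A,B$, write $A \preceq^k B$ iff every sentence of $L^k(\exists)$ true in $A$ is true in $B$. A graph $G$ is $k$-universal iff $H \preceq^k G$ for all graphs $H$. $\mathcal{U}^k$ is the class of $k$-universal graphs. *)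

theory Defs
  imports "Graph_Theory.Pair_Digraph" "HOL-Library.Countable_Set"
begin

section \<open>Graphs\<close>

text \<open>
  \<^const>\<open>pair_graph\<close> already says: finite vertex set, edge relation on it that is
  symmetric and irreflexive. As usual in model theory, structures have nonempty universe.
\<close>

definition fo_graph :: "'a pair_pre_digraph \<Rightarrow> bool" where
  "fo_graph G \<longleftrightarrow> pair_graph G \<and> pverts G \<noteq> {}"


section \<open>First-order formulas over the language of graphs\<close>

text \<open>The number \<open>i\<close> stands for the variable \<open>x\<^sub>i\<close>.\<close>

datatype fm =
    FEq nat nat
  | FEdge nat nat
  | FNeg fm
  | FConj fm fm
  | FDisj fm fm
  | FEx nat fm
  | FAll nat fm

fun atomic_fm :: "fm \<Rightarrow> bool" where
  "atomic_fm (FEq i j) \<longleftrightarrow> True"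
| "atomic_fm (FEdge i j) \<longleftrightarrow> True"
| "atomic_fm _ \<longleftrightarrow> False"

primrec free_vars :: "fm \<Rightarrow> nat set" where
  "free_vars (FEq i j) = {i, j}"
| "free_vars (FEdge i j) = {i, j}"
| "free_vars (FNeg \<phi>) = free_vars \<phi>"
| "free_vars (FConj \<phi> \<psi>) = free_vars \<phi> \<union> free_vars \<psi>"
| "free_vars (FDisj \<phi> \<psi>) = free_vars \<phi> \<union> free_vars \<psi>"
| "free_vars (FEx i \<phi>) = free_vars \<phi> - {i}"
| "free_vars (FAll i \<phi>) = free_vars \<phi> - {i}"

primrec all_vars :: "fm \<Rightarrow> nat set" where
  "all_vars (FEq i j) = {i, j}"
| "all_vars (FEdge i j) = {i, j}"
| "all_vars (FNeg \<phi>) = all_vars \<phi>"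
| "all_vars (FConj \<phi> \<psi>) = all_vars \<phi> \<union> all_vars \<psi>"
| "all_vars (FDisj \<phi> \<psi>) = all_vars \<phi> \<union> all_vars \<psi>"
| "all_vars (FEx i \<phi>) = insert i (all_vars \<phi>)"
| "all_vars (FAll i \<phi>) = insert i (all_vars \<phi>)"

primrec sat :: "'a pair_pre_digraph \<Rightarrow> (nat \<Rightarrow> 'a) \<Rightarrow> fm \<Rightarrow> bool" where
  "sat G \<rho> (FEq i j) \<longleftrightarrow> \<rho> i = \<rho> j"
| "sat G \<rho> (FEdge i j) \<longleftrightarrow> (\<rho> i, \<rho> j) \<in> parcs G"
| "sat G \<rho> (FNeg \<phi>) \<longleftrightarrow> \<not> sat G \<rho> \<phi>"
| "sat G \<rho> (FConj \<phi> \<psi>) \<longleftrightarrow> sat G \<rho> \<phi> \<and> sat G \<rho> \<psi>"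
| "sat G \<rho> (FDisj \<phi> \<psi>) \<longleftrightarrow> sat G \<rho> \<phi> \<or> sat G \<rho> \<psi>"
| "sat G \<rho> (FEx i \<phi>) \<longleftrightarrow> (\<exists>a \<in> pverts G. sat G (\<rho>(i := a)) \<phi>)"
| "sat G \<rho> (FAll i \<phi>) \<longleftrightarrow> (\<forall>a \<in> pverts G. sat G (\<rho>(i := a)) \<phi>)"

definition sentence :: "fm \<Rightarrow> bool" where
  "sentence \<phi> \<longleftrightarrow> free_vars \<phi> = {}"

definition models :: "'a pair_pre_digraph \<Rightarrow> fm \<Rightarrow> bool" where
  "models G \<phi> \<longleftrightarrow> (\<forall>\<rho>. range \<rho> \<subseteq> pverts G \<longrightarrow> sat G \<rho> \<phi>)"


section \<open>The finite variable fragments\<close>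

definition L :: "nat \<Rightarrow> fm set" where
  "L k = {\<phi>. all_vars \<phi> \<subseteq> {1..k}}"

inductive_set L_ex :: "nat \<Rightarrow> fm set" for k :: nat where
  atom: "atomic_fm \<phi> \<Longrightarrow> \<phi> \<in> L k \<Longrightarrow> \<phi> \<in> L_ex k"
| neg_atom: "atomic_fm \<phi> \<Longrightarrow> \<phi> \<in> L k \<Longrightarrow> FNeg \<phi> \<in> L_ex k"
| conj: "\<phi> \<in> L_ex k \<Longrightarrow> \<psi> \<in> L_ex k \<Longrightarrow> FConj \<phi> \<psi> \<in> L_ex k"
| disj: "\<phi> \<in> L_ex k \<Longrightarrow> \<psi> \<in> L_ex k \<Longrightarrow> FDisj \<phi> \<psi> \<in> L_ex k"
| ex: "\<phi> \<in> L_ex k \<Longrightarrow> i \<in> {1..k} \<Longrightarrow> FEx i \<phi> \<in> L_ex k"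

text \<open>A countable disjunction is represented by the countable set of its disjuncts.\<close>

definition bigvee_L_ex :: "nat \<Rightarrow> fm set set" where
  "bigvee_L_ex k = {\<Phi>. countable \<Phi> \<and> \<Phi> \<subseteq> L_ex k}"

definition bigvee_sentence :: "fm set \<Rightarrow> bool" where
  "bigvee_sentence \<Phi> \<longleftrightarrow> (\<Union>\<phi>\<in>\<Phi>. free_vars \<phi>) = {}"

definition bigvee_sat :: "'a pair_pre_digraph \<Rightarrow> (nat \<Rightarrow> 'a) \<Rightarrow> fm set \<Rightarrow> bool" where
  "bigvee_sat G \<rho> \<Phi> \<longleftrightarrow> (\<exists>\<phi>\<in>\<Phi>. sat G \<rho> \<phi>)"

definition bigvee_models :: "'a pair_pre_digraph \<Rightarrow> fm set \<Rightarrow> bool" where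
  "bigvee_models G \<Phi> \<longleftrightarrow> (\<forall>\<rho>. range \<rho> \<subseteq> pverts G \<longrightarrow> bigvee_sat G \<rho> \<Phi>)"


section \<open>Universal graphs\<close>

definition preceq_L_ex :: "nat \<Rightarrow> 'a pair_pre_digraph \<Rightarrow> 'b pair_pre_digraph \<Rightarrow> bool" where
  "preceq_L_ex k A B \<longleftrightarrow> (\<forall>\<phi> \<in> L_ex k. sentence \<phi> \<longrightarrow> models A \<phi> \<longrightarrow> models B \<phi>)"

text \<open>
  A HOL formula cannot quantify over graphs with vertices in all types. As graphs are finite,
  each is isomorphic to one with vertices in \<^typ>\<open>nat\<close>, and it suffices to let \<open>H\<close> range over
  those; see \<open>k_universal_imp_preceq\<close> and \<open>defines_universal_transfer\<close> below.
\<close>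

definition k_universal :: "nat \<Rightarrow> 'a pair_pre_digraph \<Rightarrow> bool" where
  "k_universal k G \<longleftrightarrow>
     fo_graph G \<and> (\<forall>H :: nat pair_pre_digraph. fo_graph H \<longrightarrow> preceq_L_ex k H G)"

definition U :: "nat \<Rightarrow> 'a pair_pre_digraph set" where
  "U k = {G. k_universal k G}"


section \<open>Vertices in \<open>nat\<close> suffice\<close>

definition fo_iso :: "('a \<Rightarrow> 'b) \<Rightarrow> 'a pair_pre_digraph \<Rightarrow> 'b pair_pre_digraph \<Rightarrow> bool" where
  "fo_iso f G H \<longleftrightarrow> bij_betw f (pverts G) (pverts H) \<and>
     (\<forall>a\<in>pverts G. \<forall>b\<in>pverts G. (a, b) \<in> parcs G \<longleftrightarrow> (f a, f b) \<in> parcs H)"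

lemma sat_iso:
  assumes iso: "fo_iso f G H" and "range \<rho> \<subseteq> pverts G"
  shows "sat G \<rho> \<phi> \<longleftrightarrow> sat H (f \<circ> \<rho>) \<phi>"
  using assms(2)
proof (induction \<phi> arbitrary: \<rho>)
  case (FEq i j)
  then have "\<rho> i \<in> pverts G" "\<rho> j \<in> pverts G" by auto
  then show ?case
    using iso by (auto simp: fo_iso_def bij_betw_def dest: inj_onD)
next
  case (FEdge i j)
  then have "\<rho> i \<in> pverts G" "\<rho> j \<in> pverts G" by auto
  then show ?case
    using iso by (simp add: fo_iso_def)
next
  case (FEx i \<phi>)
  have "sat G (\<rho>(i := a)) \<phi> \<longleftrightarrow> sat H ((f \<circ> \<rho>)(i := f a)) \<phi>" if "a \<in> pverts G" for a
  proof -
    have "range (\<rho>(i := a)) \<subseteq> pverts G" using FEx.prems that by auto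
    moreover have "f \<circ> \<rho>(i := a) = (f \<circ> \<rho>)(i := f a)" by (simp add: fun_eq_iff)
    ultimately show ?thesis using FEx.IH by metis
  qed
  moreover have "pverts H = f ` pverts G"
    using iso by (auto simp: fo_iso_def bij_betw_def)
  ultimately show ?case by (simp only: sat.simps bex_simps cong: bex_cong)
next
  case (FAll i \<phi>)
  have "sat G (\<rho>(i := a)) \<phi> \<longleftrightarrow> sat H ((f \<circ> \<rho>)(i := f a)) \<phi>" if "a \<in> pverts G" for a
  proof -
    have "range (\<rho>(i := a)) \<subseteq> pverts G" using FAll.prems that by auto
    moreover have "f \<circ> \<rho>(i := a) = (f \<circ> \<rho>)(i := f a)" by (simp add: fun_eq_iff)
    ultimately show ?thesis using FAll.IH by metis
  qed
  moreover have "pverts H = f ` pverts G"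
    using iso by (auto simp: fo_iso_def bij_betw_def)
  ultimately show ?case by (simp only: sat.simps ball_simps cong: ball_cong)
qed auto

lemma range_iso:
  assumes iso: "fo_iso f G H"
  shows "(\<forall>\<rho>. range \<rho> \<subseteq> pverts H \<longrightarrow> P \<rho>) \<longleftrightarrow> (\<forall>\<rho>. range \<rho> \<subseteq> pverts G \<longrightarrow> P (f \<circ> \<rho>))"
proof safe
  fix \<rho> :: "'c \<Rightarrow> 'a"
  assume *: "\<forall>\<rho>. range \<rho> \<subseteq> pverts H \<longrightarrow> P \<rho>" and \<rho>: "range \<rho> \<subseteq> pverts G"
  have "f ` pverts G = pverts H"
    using iso by (simp add: fo_iso_def bij_betw_def)
  then have "range (f \<circ> \<rho>) \<subseteq> pverts H"
    using \<rho> by auto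
  then show "P (f \<circ> \<rho>)"
    using * by blast
next
  fix \<rho> :: "'c \<Rightarrow> 'b"
  assume *: "\<forall>\<rho>. range \<rho> \<subseteq> pverts G \<longrightarrow> P (f \<circ> \<rho>)" and \<rho>: "range \<rho> \<subseteq> pverts H"
  let ?g = "the_inv_into (pverts G) f"
  have f: "inj_on f (pverts G)" "f ` pverts G = pverts H"
    using iso by (auto simp: fo_iso_def bij_betw_def)
  have "range (?g \<circ> \<rho>) \<subseteq> pverts G"
    using \<rho> f the_inv_into_into[OF f(1) _ subset_refl] by fastforce
  moreover have "f \<circ> (?g \<circ> \<rho>) = \<rho>"
  proof
    fix i
    have "\<rho> i \<in> f ` pverts G" using \<rho> f(2) by auto
    then show "(f \<circ> (?g \<circ> \<rho>)) i = \<rho> i"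
      using f_the_inv_into_f[OF f(1)] by simp
  qed
  ultimately show "P \<rho>"
    using * by metis
qed

lemma models_iso: "fo_iso f G H \<Longrightarrow> models G \<phi> \<longleftrightarrow> models H \<phi>"
  by (auto simp: models_def range_iso sat_iso)

lemma bigvee_models_iso: "fo_iso f G H \<Longrightarrow> bigvee_models G \<Phi> \<longleftrightarrow> bigvee_models H \<Phi>"
  by (auto simp: bigvee_models_def bigvee_sat_def range_iso sat_iso)

lemma nat_copy:
  fixes G :: "'a pair_pre_digraph"
  assumes G: "fo_graph G"
  obtains f and H :: "nat pair_pre_digraph" where "fo_graph H" "fo_iso f G H"
proof -
  interpret pair_graph G using G by (simp add: fo_graph_def)
  obtain f :: "'a \<Rightarrow> nat" where f: "inj_on f (pverts G)"
    using pair_finite_verts finite_imp_inj_to_nat_seg by metis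
  define H where "H = \<lparr> pverts = f ` pverts G, parcs = map_prod f f ` parcs G \<rparr>"
  have arcs: "u \<in> pverts G" "v \<in> pverts G" "u \<noteq> v" "(v, u) \<in> parcs G" if "(u, v) \<in> parcs G" for u v
    using in_arcsD1[OF that] in_arcsD2[OF that] pair_no_loops[OF that] pair_sym_arcs that
    by (auto simp: symmetric_def dest: symD)
  have "sym (parcs H)"
    using arcs(4) by (force simp: H_def sym_def)
  moreover have "fst e \<noteq> snd e" if e: "e \<in> parcs H" for e
  proof -
    obtain u v where "(u, v) \<in> parcs G" "e = (f u, f v)"
      using e by (auto simp: H_def)
    then show ?thesis
      using arcs(1-3)[of u v] inj_onD[OF f, of u v] by auto
  qed
  ultimately have "pair_graph H"
    using pair_finite_verts pair_finite_arcs arcs(1,2)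
    by unfold_locales (auto simp: H_def symmetric_def)
  then have "fo_graph H"
    using G by (simp add: fo_graph_def H_def)
  moreover have "fo_iso f G H"
    unfolding fo_iso_def
  proof (intro conjI ballI)
    show "bij_betw f (pverts G) (pverts H)"
      using f by (simp add: bij_betw_def H_def)
    fix a b
    assume "a \<in> pverts G" "b \<in> pverts G"
    then show "(a, b) \<in> parcs G \<longleftrightarrow> (f a, f b) \<in> parcs H"
      using arcs(1,2) inj_on_eq_iff[OF f] by (fastforce simp: H_def)
  qed
  ultimately show thesis by (rule that)
qed

lemma k_universal_imp_preceq:
  fixes G :: "'a pair_pre_digraph" and H :: "'b pair_pre_digraph"
  assumes "k_universal k G" "fo_graph H"
  shows "preceq_L_ex k H G"
proof -
  obtain f and H' :: "nat pair_pre_digraph" where "fo_graph H'" "fo_iso f H H'"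
    using nat_copy assms(2) by blast
  then show ?thesis
    using assms(1) by (simp add: k_universal_def preceq_L_ex_def models_iso)
qed

lemma defines_universal_transfer:
  fixes G :: "'a pair_pre_digraph"
  assumes "\<forall>G :: nat pair_pre_digraph. fo_graph G \<longrightarrow> (G \<in> U k \<longleftrightarrow> bigvee_models G \<Phi>)"
    and "fo_graph G"
  shows "G \<in> U k \<longleftrightarrow> bigvee_models G \<Phi>"
proof -
  obtain f and G' :: "nat pair_pre_digraph" where "fo_graph G'" "fo_iso f G G'"
    using nat_copy assms(2) by blast
  then show ?thesis
    using assms by (simp add: U_def k_universal_def preceq_L_ex_def models_iso bigvee_models_iso)
qed

end

theory Submission
  imports Defs Complex_Main
begin

text \<open>
  Let \<open>G\<close> be a random graph with \<open>n = q\<^sup>k\<close> vertices and edge probability \<open>1/q\<close>. For large \<open>q\<close> it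
  satisfies all extension axioms for fewer than \<open>k\<close> points, hence is \<open>k\<close>-universal, and its subgraphs
  with at most \<open>M\<close> vertices have fewer than \<open>k + 1\<close> edges per vertex.

  A sentence of \<open>L\<^bsup>k'\<^esup>(\<exists>)\<close> true in \<open>G\<close> looks at \<open>k'\<close> points at a time. Around these points one keeps
  a set of bounded size with minimal predimension \<open>c |S| - 2 e(S)\<close>; gluing copies of
  such sets freely, as the witnesses of the sentence demand, builds a graph that satisfies the
  sentence and is sparse throughout. A \<open>k\<close>-universal graph has a nonempty subgraph of minimum degree
  at least \<open>2\<^bsup>k-2\<^esup>\<close>, since all patterns over \<open>k - 2\<close> points are realised among the neighbours
  of each of its points. For \<open>k \<ge> 7\<close> this is too dense, so the new graph is not \<open>k\<close>-universal.
\<close>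

section \<open>Graphs and formulas\<close>

lemma fo_graphI:
  assumes "finite (pverts G)" "pverts G \<noteq> {}" "parcs G \<subseteq> pverts G \<times> pverts G"
    and "\<And>u v. (u, v) \<in> parcs G \<Longrightarrow> (v, u) \<in> parcs G" "\<And>u. (u, u) \<notin> parcs G"
  shows "fo_graph G"
proof -
  have "finite (parcs G)"
    using assms(1,3) by (meson finite_SigmaI finite_subset)
  moreover have "fst e \<noteq> snd e" if "e \<in> parcs G" for e
    using assms(5) that by (metis prod.collapse)
  ultimately have "pair_graph G"
    using assms by unfold_locales (auto simp: symmetric_def intro!: symI)
  then show ?thesis
    using assms(2) by (simp add: fo_graph_def)
qed

lemma fo_graphD:
  assumes "fo_graph G"
  shows "finite (pverts G)" "pverts G \<noteq> {}" "parcs G \<subseteq> pverts G \<times> pverts G"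
    "(u, v) \<in> parcs G \<Longrightarrow> (v, u) \<in> parcs G" "(u, u) \<notin> parcs G"
proof -
  interpret pair_graph G using assms by (simp add: fo_graph_def)
  show "finite (pverts G)" "parcs G \<subseteq> pverts G \<times> pverts G"
    using pair_finite_verts in_arcsD1 in_arcsD2 by auto
  show "(u, u) \<notin> parcs G" using pair_no_loops[of "(u, u)"] by auto
  show "pverts G \<noteq> {}" using assms by (simp add: fo_graph_def)
  show "(u, v) \<in> parcs G \<Longrightarrow> (v, u) \<in> parcs G"
    using pair_sym_arcs by (auto simp: symmetric_def dest: symD)
qed

lemma free_vars_subset_all_vars: "free_vars \<phi> \<subseteq> all_vars \<phi>"
  by (induction \<phi>) auto

lemma sat_cong:
  assumes "\<And>i. i \<in> free_vars \<phi> \<Longrightarrow> \<rho> i = \<sigma> i"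
  shows "sat G \<rho> \<phi> \<longleftrightarrow> sat G \<sigma> \<phi>"
  using assms
proof (induction \<phi> arbitrary: \<rho> \<sigma>)
  case (FEx i \<phi>)
  have "sat G (\<rho>(i := a)) \<phi> \<longleftrightarrow> sat G (\<sigma>(i := a)) \<phi>" for a
    by (rule FEx.IH) (use FEx.prems in auto)
  then show ?case by simp
next
  case (FAll i \<phi>)
  have "sat G (\<rho>(i := a)) \<phi> \<longleftrightarrow> sat G (\<sigma>(i := a)) \<phi>" for a
    by (rule FAll.IH) (use FAll.prems in auto)
  then show ?case by simp
next
  case (FNeg \<phi>)
  then show ?case by (metis free_vars.simps(3) sat.simps(3))
next
  case (FConj \<phi> \<psi>)
  have "sat G \<rho> \<phi> \<longleftrightarrow> sat G \<sigma> \<phi>" "sat G \<rho> \<psi> \<longleftrightarrow> sat G \<sigma> \<psi>"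
    by (rule FConj.IH; use FConj.prems in simp)+
  then show ?case by simp
next
  case (FDisj \<phi> \<psi>)
  have "sat G \<rho> \<phi> \<longleftrightarrow> sat G \<sigma> \<phi>" "sat G \<rho> \<psi> \<longleftrightarrow> sat G \<sigma> \<psi>"
    by (rule FDisj.IH; use FDisj.prems in simp)+
  then show ?case by simp
qed auto

lemma all_vars_L_ex: "\<phi> \<in> L_ex k \<Longrightarrow> all_vars \<phi> \<subseteq> {1..k}"
  by (induction rule: L_ex.induct) (auto simp: L_def)

lemma sat_cong_L_ex:
  assumes "\<phi> \<in> L_ex k" "\<And>i. i \<in> {1..k} \<Longrightarrow> \<rho> i = \<sigma> i"
  shows "sat G \<rho> \<phi> \<longleftrightarrow> sat G \<sigma> \<phi>"
  using assms all_vars_L_ex[OF assms(1)] free_vars_subset_all_vars[of \<phi>]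
  by (intro sat_cong) blast

lemma atomic_fm_cases:
  assumes "atomic_fm \<phi>" "\<phi> \<in> L k"
  obtains i j where "i \<in> {1..k}" "j \<in> {1..k}" "\<phi> = FEq i j \<or> \<phi> = FEdge i j"
  using assms by (cases \<phi>) (auto simp: L_def)

section \<open>Induced subgraphs and the preservation of existential formulas\<close>

definition induced_in :: "'a pair_pre_digraph \<Rightarrow> 'a pair_pre_digraph \<Rightarrow> bool" where
  "induced_in X X' \<longleftrightarrow> pverts X \<subseteq> pverts X' \<and> parcs X = parcs X' \<inter> pverts X \<times> pverts X"

lemma induced_in_refl: "parcs X \<subseteq> pverts X \<times> pverts X \<Longrightarrow> induced_in X X"
  by (auto simp: induced_in_def)

lemma induced_in_trans: "induced_in X Y \<Longrightarrow> induced_in Y Z \<Longrightarrow> induced_in X Z"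
  by (auto simp: induced_in_def)

text \<open>Literals on vertices of \<open>X\<close> are already decided in \<open>X\<close>, and a
  witness in \<open>X\<close> is still one in \<open>X'\<close>. So enlarging a graph never destroys
  an existential statement about its old vertices.\<close>

lemma sat_induced_in:
  assumes "\<phi> \<in> L_ex k" "induced_in X X'" "\<rho> ` {1..k} \<subseteq> pverts X" "sat X \<rho> \<phi>"
  shows "sat X' \<rho> \<phi>"
  using assms
proof (induction arbitrary: \<rho> rule: L_ex.induct)
  case (atom \<phi>)
  obtain i j where "i \<in> {1..k}" "j \<in> {1..k}" "\<phi> = FEq i j \<or> \<phi> = FEdge i j"
    using atom by (elim atomic_fm_cases)
  moreover from this have "\<rho> i \<in> pverts X" "\<rho> j \<in> pverts X" using atom by auto
  ultimately show ?case using atom by (auto simp: induced_in_def)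
next
  case (neg_atom \<phi>)
  obtain i j where "i \<in> {1..k}" "j \<in> {1..k}" "\<phi> = FEq i j \<or> \<phi> = FEdge i j"
    using neg_atom by (elim atomic_fm_cases)
  moreover from this have "\<rho> i \<in> pverts X" "\<rho> j \<in> pverts X" using neg_atom by auto
  ultimately show ?case using neg_atom by (auto simp: induced_in_def)
next
  case (ex \<phi> i)
  obtain a where a: "a \<in> pverts X" "sat X (\<rho>(i := a)) \<phi>" using ex.prems by auto
  have "sat X' (\<rho>(i := a)) \<phi>"
  proof (rule ex.IH)
    show "(\<rho>(i := a)) ` {1..k} \<subseteq> pverts X" using ex.prems(2) a(1) by auto
  qed (fact ex.prems(1) a(2))+
  then show ?case using a(1) ex.prems(1) by (auto simp: induced_in_def)
qed auto


section \<open>Extension axioms\<close>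

definition extendible :: "nat \<Rightarrow> 'a pair_pre_digraph \<Rightarrow> bool" where
  "extendible k G \<longleftrightarrow> (\<forall>A B. B \<subseteq> A \<longrightarrow> A \<subseteq> pverts G \<longrightarrow> card A < k \<longrightarrow>
     (\<exists>v \<in> pverts G - A. \<forall>a\<in>A. (v, a) \<in> parcs G \<longleftrightarrow> a \<in> B))"

lemma extendibleD:
  assumes "extendible k G" "A \<subseteq> pverts G" "card A < k"
  shows "\<exists>v\<in>pverts G - A. \<forall>a\<in>A. (v, a) \<in> parcs G \<longleftrightarrow> P a"
proof -
  have "{a\<in>A. P a} \<subseteq> A" by blast
  then obtain v where "v \<in> pverts G - A" "\<forall>a\<in>A. (v, a) \<in> parcs G \<longleftrightarrow> a \<in> {a\<in>A. P a}"
    using assms unfolding extendible_def by meson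
  then show ?thesis by auto
qed

text \<open>This is Duplicator's strategy in the existential \<open>k\<close>-pebble game from
  \<open>H\<close> to \<open>G\<close>: \<open>\<rho>\<close> and \<open>\<sigma>\<close> place the
  pebbles in positions of the same atomic type. Moving one pebble leaves at most
  \<open>k - 1\<close> occupied vertices, so an extension axiom supplies the answer.\<close>

lemma extendible_sat:
  assumes "extendible k G" "fo_graph G" "fo_graph H" "\<phi> \<in> L_ex k"
    and "\<sigma> ` {1..k} \<subseteq> pverts G"
    and "\<And>i j. i \<in> {1..k} \<Longrightarrow> j \<in> {1..k} \<Longrightarrow>
      (\<rho> i = \<rho> j \<longleftrightarrow> \<sigma> i = \<sigma> j) \<and> ((\<rho> i, \<rho> j) \<in> parcs H \<longleftrightarrow> (\<sigma> i, \<sigma> j) \<in> parcs G)"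
    and "sat H \<rho> \<phi>"
  shows "sat G \<sigma> \<phi>"
  using assms(4-)
proof (induction arbitrary: \<rho> \<sigma> rule: L_ex.induct)
  case (atom \<phi>)
  obtain i j where "i \<in> {1..k}" "j \<in> {1..k}" "\<phi> = FEq i j \<or> \<phi> = FEdge i j"
    using atom(1,2) by (elim atomic_fm_cases)
  then show ?case using atom.prems(2)[of i j] atom.prems(3) by auto
next
  case (neg_atom \<phi>)
  obtain i j where "i \<in> {1..k}" "j \<in> {1..k}" "\<phi> = FEq i j \<or> \<phi> = FEdge i j"
    using neg_atom(1,2) by (elim atomic_fm_cases)
  then show ?case using neg_atom.prems(2)[of i j] neg_atom.prems(3) by auto
next
  case (conj \<phi> \<psi>)
  have "sat G \<sigma> \<phi>" by (rule conj.IH(1)[of \<sigma> \<rho>]) (use conj.prems in auto)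
  moreover have "sat G \<sigma> \<psi>" by (rule conj.IH(2)[of \<sigma> \<rho>]) (use conj.prems in auto)
  ultimately show ?case by simp
next
  case (disj \<phi> \<psi>)
  from disj.prems(3) consider "sat H \<rho> \<phi>" | "sat H \<rho> \<psi>" by auto
  then have "sat G \<sigma> \<phi> \<or> sat G \<sigma> \<psi>"
  proof cases
    case 1
    have "sat G \<sigma> \<phi>" by (rule disj.IH(1)[of \<sigma> \<rho>]) (use disj.prems 1 in auto)
    then show ?thesis ..
  next
    case 2
    have "sat G \<sigma> \<psi>" by (rule disj.IH(2)[of \<sigma> \<rho>]) (use disj.prems 2 in auto)
    then show ?thesis ..
  qed
  then show ?case by simp
next
  case (ex \<phi> i)
  obtain a where a: "a \<in> pverts H" "sat H (\<rho>(i := a)) \<phi>" using ex.prems(3) by auto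
  let ?J = "{1..k} - {i}"
  \<comment> \<open>If \<open>a\<close> already carries another pebble, the answer is forced;
    otherwise it must be a new vertex with the right adjacencies.\<close>
  have "\<exists>v\<in>pverts G. \<forall>j\<in>?J. (a = \<rho> j \<longleftrightarrow> v = \<sigma> j) \<and> ((a, \<rho> j) \<in> parcs H \<longleftrightarrow> (v, \<sigma> j) \<in> parcs G)"
  proof (cases "a \<in> \<rho> ` ?J")
    case True
    then obtain j where "j \<in> ?J" "a = \<rho> j" by blast
    then show ?thesis using ex.prems(1,2) by (intro bexI[of _ "\<sigma> j"]) auto
  next
    case False
    have "card (\<sigma> ` ?J) \<le> card ?J" by (rule card_image_le) simp
    also have "\<dots> < k" using ex.hyps(2) by auto
    finally have card: "card (\<sigma> ` ?J) < k" .
    have sub: "\<sigma> ` ?J \<subseteq> pverts G" using ex.prems(1) by auto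
    \<comment> \<open>The pattern is given on indices but prescribed on vertices; this is well
      defined because \<open>\<rho>\<close> and \<open>\<sigma>\<close> identify the same
      indices.\<close>
    obtain v where v: "v \<in> pverts G - \<sigma> ` ?J"
      "\<forall>b\<in>\<sigma> ` ?J. (v, b) \<in> parcs G \<longleftrightarrow> (\<exists>j\<in>?J. b = \<sigma> j \<and> (a, \<rho> j) \<in> parcs H)"
      by (rule bexE[OF extendibleD[OF assms(1) sub card]])
    show ?thesis
    proof (intro bexI[of _ v] ballI conjI)
      fix j assume j: "j \<in> ?J"
      show "a = \<rho> j \<longleftrightarrow> v = \<sigma> j" using False v(1) j by blast
      have "\<rho> j = \<rho> j'" if "j' \<in> ?J" "\<sigma> j = \<sigma> j'" for j'
        using ex.prems(2)[of j j'] that j by simp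
      moreover have "(v, \<sigma> j) \<in> parcs G \<longleftrightarrow> (\<exists>j'\<in>?J. \<sigma> j = \<sigma> j' \<and> (a, \<rho> j') \<in> parcs H)"
        using v(2) j by simp
      ultimately show "(a, \<rho> j) \<in> parcs H \<longleftrightarrow> (v, \<sigma> j) \<in> parcs G"
        using j by metis
    qed (use v(1) in blast)
  qed
  then obtain v where v: "v \<in> pverts G"
    "\<And>j. j \<in> ?J \<Longrightarrow> (a = \<rho> j \<longleftrightarrow> v = \<sigma> j) \<and> ((a, \<rho> j) \<in> parcs H \<longleftrightarrow> (v, \<sigma> j) \<in> parcs G)"
    by blast
  have "sat G (\<sigma>(i := v)) \<phi>"
  proof (rule ex.IH[of _ "\<rho>(i := a)"])
    show "(\<sigma>(i := v)) ` {1..k} \<subseteq> pverts G" using ex.prems(1) v(1) by auto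
    fix j l assume jl: "j \<in> {1..k}" "l \<in> {1..k}"
    have "((\<rho>(i := a)) j, a) \<in> parcs H \<longleftrightarrow> (a, (\<rho>(i := a)) j) \<in> parcs H"
      "((\<sigma>(i := v)) j, v) \<in> parcs G \<longleftrightarrow> (v, (\<sigma>(i := v)) j) \<in> parcs G"
      using fo_graphD(4)[OF assms(3)] fo_graphD(4)[OF assms(2)] by blast+
    then show "((\<rho>(i := a)) j = (\<rho>(i := a)) l \<longleftrightarrow> (\<sigma>(i := v)) j = (\<sigma>(i := v)) l) \<and>
        (((\<rho>(i := a)) j, (\<rho>(i := a)) l) \<in> parcs H \<longleftrightarrow> ((\<sigma>(i := v)) j, (\<sigma>(i := v)) l) \<in> parcs G)"
      using v(2)[of j] v(2)[of l] ex.prems(2)[OF jl] jl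
        fo_graphD(5)[OF assms(3)] fo_graphD(5)[OF assms(2)]
      by (cases "j = i"; cases "l = i") auto
  qed (fact a)
  then show ?case using v(1) by auto
qed

text \<open>All pebbles start on a single vertex on either side; by irreflexivity these positions
  match. Truth of a sentence does not depend on the assignment.\<close>

lemma extendible_imp_universal:
  assumes "extendible k G" "fo_graph G"
  shows "k_universal k G"
  unfolding k_universal_def preceq_L_ex_def models_def
proof (intro conjI allI impI ballI)
  show "fo_graph G" by fact
  fix H :: "nat pair_pre_digraph" and \<phi> \<rho>
  assume H: "fo_graph H" and \<phi>: "\<phi> \<in> L_ex k" "sentence \<phi>"
    and sat: "\<forall>\<rho>. range \<rho> \<subseteq> pverts H \<longrightarrow> sat H \<rho> \<phi>"
  obtain a b where ab: "a \<in> pverts H" "b \<in> pverts G"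
    using fo_graphD(2) H assms(2) by (metis ex_in_conv)
  have "sat G (\<lambda>_. b) \<phi>"
    by (rule extendible_sat[OF assms H \<phi>(1), where \<rho> = "\<lambda>_. a"])
      (use ab sat fo_graphD(5)[OF H] fo_graphD(5)[OF assms(2)] in auto)
  then show "sat G \<rho> \<phi>"
    using \<phi>(2) by (subst sat_cong[of _ _ "\<lambda>_. b"]) (auto simp: sentence_def)
qed


section \<open>Universal graphs have dense parts\<close>

definition big_conj :: "fm list \<Rightarrow> fm" where
  "big_conj \<phi>s = foldr FConj \<phi>s (FEq 1 1)"

lemma sat_big_conj: "sat G \<rho> (big_conj \<phi>s) \<longleftrightarrow> (\<forall>\<phi>\<in>set \<phi>s. sat G \<rho> \<phi>)"
  by (induction \<phi>s) (auto simp: big_conj_def)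

lemma sat_big_conj_map: "sat G \<rho> (big_conj (map f xs)) \<longleftrightarrow> (\<forall>x\<in>set xs. sat G \<rho> (f x))"
  by (simp add: sat_big_conj)

text \<open>Variable \<open>1\<close> appears because \<open>FEq 1 1\<close> stands for the empty
  conjunction.\<close>

lemma free_vars_big_conj: "free_vars (big_conj \<phi>s) = insert 1 (\<Union>\<phi>\<in>set \<phi>s. free_vars \<phi>)"
  by (induction \<phi>s) (auto simp: big_conj_def)

lemma big_conj_L_ex: "k \<ge> 1 \<Longrightarrow> set \<phi>s \<subseteq> L_ex k \<Longrightarrow> big_conj \<phi>s \<in> L_ex k"
  by (induction \<phi>s) (auto simp: big_conj_def L_def intro: L_ex.intros)

definition big_ex :: "nat list \<Rightarrow> fm \<Rightarrow> fm" where
  "big_ex js \<phi> = foldr FEx js \<phi>"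

lemma sat_big_ex:
  "sat G \<rho> (big_ex js \<phi>) \<longleftrightarrow>
    (\<exists>\<tau>. \<tau> ` set js \<subseteq> pverts G \<and> sat G (\<lambda>i. if i \<in> set js then \<tau> i else \<rho> i) \<phi>)"
proof (induction js arbitrary: \<rho>)
  case Nil
  then show ?case by (simp add: big_ex_def)
next
  case (Cons j js)
  have "sat G \<rho> (big_ex (j # js) \<phi>) \<longleftrightarrow> (\<exists>a\<in>pverts G. \<exists>\<tau>. \<tau> ` set js \<subseteq> pverts G \<and>
      sat G (\<lambda>i. if i \<in> set js then \<tau> i else (\<rho>(j := a)) i) \<phi>)"
    using Cons by (simp add: big_ex_def)
  also have "\<dots> \<longleftrightarrow> (\<exists>\<tau>. \<tau> ` set (j # js) \<subseteq> pverts G \<and>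
      sat G (\<lambda>i. if i \<in> set (j # js) then \<tau> i else \<rho> i) \<phi>)" (is "?l \<longleftrightarrow> ?r")
  proof
    assume ?l
    then obtain a \<tau> where "a \<in> pverts G" "\<tau> ` set js \<subseteq> pverts G"
      and sat: "sat G (\<lambda>i. if i \<in> set js then \<tau> i else (\<rho>(j := a)) i) \<phi>" by blast
    \<comment> \<open>If \<open>j\<close> recurs in \<open>js\<close>, the inner quantifier
      overrides the outer one, so \<open>a\<close> counts only when \<open>j\<close> does not
      recur.\<close>
    moreover have "(\<lambda>i. if i \<in> set js then \<tau> i else (\<rho>(j := a)) i) =
      (\<lambda>i. if i \<in> set (j # js) then (if i \<in> set js then \<tau> i else a) else \<rho> i)" by auto
    ultimately show ?r
      by (intro exI[of _ "\<lambda>i. if i \<in> set js then \<tau> i else a"]) auto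
  next
    assume ?r
    then obtain \<tau> where \<tau>: "\<tau> ` set (j # js) \<subseteq> pverts G"
      and sat: "sat G (\<lambda>i. if i \<in> set (j # js) then \<tau> i else \<rho> i) \<phi>" by blast
    have "(\<lambda>i. if i \<in> set (j # js) then \<tau> i else \<rho> i) =
      (\<lambda>i. if i \<in> set js then \<tau> i else (\<rho>(j := \<tau> j)) i)" by auto
    then show ?l using \<tau> sat by (intro bexI[of _ "\<tau> j"] exI[of _ \<tau>]) auto
  qed
  finally show ?case .
qed

lemma free_vars_big_ex: "free_vars (big_ex js \<phi>) = free_vars \<phi> - set js"
  by (induction js) (auto simp: big_ex_def)

lemma big_ex_L_ex: "set js \<subseteq> {1..k} \<Longrightarrow> \<phi> \<in> L_ex k \<Longrightarrow> big_ex js \<phi> \<in> L_ex k"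
  by (induction js) (auto simp: big_ex_def intro: L_ex.intros)

text \<open>
  Distinct patterns over \<open>x\<^sub>2, \<dots>, x\<^bsub>k-1\<^esub>\<close> need distinct witnesses \<open>x\<^sub>k\<close>, so \<open>dense_fm k (Suc n)\<close>
  says that \<open>x\<^sub>1\<close> has at least \<open>2\<^bsup>k-2\<^esup>\<close> neighbours that satisfy \<open>dense_fm k n\<close>.
\<close>

definition neighbour_fm :: "nat \<Rightarrow> fm \<Rightarrow> nat list \<Rightarrow> fm" where
  "neighbour_fm k \<psi> B = FEx k (FConj (FEdge 1 k) (FConj
     (big_conj (map (\<lambda>j. if j \<in> set B then FEdge k j else FNeg (FEdge k j)) [2..<k]))
     (FEx 1 (FConj (FEq 1 k) \<psi>))))"

primrec dense_fm :: "nat \<Rightarrow> nat \<Rightarrow> fm" where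
  "dense_fm k 0 = FEq 1 1"
| "dense_fm k (Suc n) =
     big_ex [2..<k] (big_conj (map (neighbour_fm k (dense_fm k n)) (subseqs [2..<k])))"

lemma free_vars_dense_fm: "free_vars (dense_fm k n) \<subseteq> {1}"
proof (induction n)
  case (Suc n)
  have "free_vars (neighbour_fm k (dense_fm k n) B) \<subseteq> {1} \<union> {2..<k}" for B
    using Suc by (auto simp: neighbour_fm_def free_vars_big_conj split: if_splits)
  then show ?case by (fastforce simp: free_vars_big_ex free_vars_big_conj)
qed simp

lemma dense_fm_L_ex:
  assumes "k \<ge> 2"
  shows "dense_fm k n \<in> L_ex k"
proof (induction n)
  case 0
  then show ?case using assms by (auto simp: L_def intro!: L_ex.intros)
next
  case (Suc n)
  have "neighbour_fm k (dense_fm k n) B \<in> L_ex k" for B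
    unfolding neighbour_fm_def using assms Suc
    by (intro L_ex.ex L_ex.conj big_conj_L_ex) (auto simp: L_def intro!: L_ex.atom L_ex.neg_atom)
  then show ?case using assms by (auto intro!: big_ex_L_ex big_conj_L_ex)
qed

text \<open>The last quantifier of \<open>neighbour_fm\<close> copies the witness from variable
  \<open>k\<close> to variable \<open>1\<close>, the only one that may be free in
  \<open>dense_fm\<close>. All other variables can then be reused, so \<open>k\<close> variables
  suffice at every depth.\<close>

lemma sat_dense_fm_Suc:
  assumes "k \<ge> 2"
  shows "sat G \<rho> (dense_fm k (Suc n)) \<longleftrightarrow> (\<exists>\<tau>. \<tau> ` {2..<k} \<subseteq> pverts G \<and>
    (\<forall>B \<subseteq> {2..<k}. \<exists>b\<in>pverts G. (\<rho> 1, b) \<in> parcs G \<and>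
      (\<forall>j\<in>{2..<k}. (b, \<tau> j) \<in> parcs G \<longleftrightarrow> j \<in> B) \<and> sat G (\<lambda>_. b) (dense_fm k n)))"
    (is "_ \<longleftrightarrow> (\<exists>\<tau>. _ \<and> (\<forall>B \<subseteq> _. ?P \<tau> B))")
proof -
  have *: "sat G (\<lambda>i. if i \<in> set [2..<k] then \<tau> i else \<rho> i) (neighbour_fm k (dense_fm k n) B)
      \<longleftrightarrow> ?P \<tau> (set B)" for \<tau> B
  proof -
    let ?r = "\<lambda>i. if i \<in> {2..<k} then \<tau> i else \<rho> i"
    have single: "sat G (r(1 := b)) (dense_fm k n) \<longleftrightarrow> sat G (\<lambda>_. b) (dense_fm k n)" for r b
      using free_vars_dense_fm by (intro sat_cong) fastforce
    have pattern: "sat G r (if j \<in> set B then FEdge k j else FNeg (FEdge k j)) \<longleftrightarrow>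
      ((r k, r j) \<in> parcs G \<longleftrightarrow> j \<in> set B)" for r j by simp
    have r: "(?r(k := b)) 1 = \<rho> 1" "(?r(k := b)) k = b"
      "j \<in> {2..<k} \<Longrightarrow> (?r(k := b)) j = \<tau> j" "((?r(k := b))(1 := a)) 1 = a"
      "((?r(k := b))(1 := a)) k = b" for a b j
      using assms by auto
    have "sat G ?r (neighbour_fm k (dense_fm k n) B) \<longleftrightarrow> (\<exists>b\<in>pverts G. (\<rho> 1, b) \<in> parcs G \<and>
        (\<forall>j\<in>{2..<k}. (b, (?r(k := b)) j) \<in> parcs G \<longleftrightarrow> j \<in> set B) \<and>
        (\<exists>a\<in>pverts G. a = b \<and> sat G (\<lambda>_. a) (dense_fm k n)))"
      unfolding neighbour_fm_def sat.simps sat_big_conj_map set_upt pattern single r(1,2,4,5) ..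
    also have "\<dots> \<longleftrightarrow> ?P \<tau> (set B)"
      by (intro bex_cong conj_cong refl) (use r(3) in simp_all)
    finally show ?thesis unfolding set_upt .
  qed
  \<comment> \<open>\<open>subseqs\<close> yields the patterns as lists; the sets of these lists are
    exactly the subsets of \<open>{2..<k}\<close>.\<close>
  have **: "(\<forall>B\<in>set (subseqs [2..<k]). ?P \<tau> (set B)) \<longleftrightarrow> (\<forall>B \<subseteq> {2..<k}. ?P \<tau> B)" for \<tau>
  proof -
    have "(\<forall>B\<in>set (subseqs [2..<k]). ?P \<tau> (set B)) \<longleftrightarrow>
        (\<forall>B\<in>set ` set (subseqs [2..<k]). ?P \<tau> B)"
      unfolding ball_simps ..
    also have "\<dots> \<longleftrightarrow> (\<forall>B \<subseteq> {2..<k}. ?P \<tau> B)" unfolding subseqs_powset Ball_def Pow_iff set_upt ..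
    finally show ?thesis .
  qed
  show ?thesis
    unfolding dense_fm.simps sat_big_ex sat_big_conj_map * ** unfolding set_upt ..
qed

text \<open>Any \<open>k - 2\<close> vertices other than \<open>\<rho> 1\<close> can serve as the
  parameters: together with \<open>\<rho> 1\<close> they are \<open>k - 1\<close> vertices, so every
  pattern over them is realised by a neighbour of \<open>\<rho> 1\<close>, to which the induction
  hypothesis applies.\<close>

lemma extendible_dense_fm:
  assumes "k \<ge> 2" "extendible k H" "fo_graph H" "card (pverts H) \<ge> k" "\<rho> 1 \<in> pverts H"
  shows "sat H \<rho> (dense_fm k n)"
  using assms(5)
proof (induction n arbitrary: \<rho>)
  case (Suc n)
  have "card (pverts H - {\<rho> 1}) = card (pverts H) - 1"
    using Suc.prems fo_graphD(1)[OF assms(3)] by simp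
  then have "k - 2 \<le> card (pverts H - {\<rho> 1})" using assms(4) by simp
  then obtain C where C: "C \<subseteq> pverts H - {\<rho> 1}" "card C = k - 2" "finite C"
    using obtain_subset_with_card_n by metis
  then obtain \<tau> where "bij_betw \<tau> {2..<k} C"
    using finite_same_card_bij[of "{2..<k}" C] by auto
  then have \<tau>: "inj_on \<tau> {2..<k}" "\<tau> ` {2..<k} = C" by (auto simp: bij_betw_def)
  have sub: "insert (\<rho> 1) C \<subseteq> pverts H" using C(1) Suc.prems by blast
  have card: "card (insert (\<rho> 1) C) < k"
    using C assms(1) card_insert_le_m1[of "k - 1" C "\<rho> 1"]
    by (simp add: numeral_2_eq_2)
  have "\<exists>b\<in>pverts H. (\<rho> 1, b) \<in> parcs H \<and>
      (\<forall>j\<in>{2..<k}. (b, \<tau> j) \<in> parcs H \<longleftrightarrow> j \<in> B) \<and> sat H (\<lambda>_. b) (dense_fm k n)"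
    if B: "B \<subseteq> {2..<k}" for B
  proof -
    obtain b where b: "b \<in> pverts H - insert (\<rho> 1) C"
      "\<forall>a\<in>insert (\<rho> 1) C. (b, a) \<in> parcs H \<longleftrightarrow> a = \<rho> 1 \<or> a \<in> \<tau> ` B"
      by (rule bexE[OF extendibleD[OF assms(2) sub card]])
    have "(b, \<tau> j) \<in> parcs H \<longleftrightarrow> j \<in> B" if j: "j \<in> {2..<k}" for j
    proof -
      have "\<tau> j \<in> C" "\<tau> j \<noteq> \<rho> 1" using \<tau>(2) j C(1) by blast+
      then show ?thesis using b(2) inj_on_image_mem_iff[OF \<tau>(1) j B] by simp
    qed
    moreover have "(\<rho> 1, b) \<in> parcs H" using b(2) fo_graphD(4)[OF assms(3)] by blast
    moreover have "sat H (\<lambda>_. b) (dense_fm k n)" using b(1) by (intro Suc.IH) simp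
    ultimately show ?thesis using b(1) by blast
  qed
  moreover have "\<tau> ` {2..<k} \<subseteq> pverts H" using \<tau>(2) C(1) by auto
  ultimately show ?case
    unfolding sat_dense_fm_Suc[OF assms(1)] by (intro exI[of _ \<tau>] conjI allI impI)
qed simp

text \<open>The sentences \<open>FEx 1 (dense_fm k n)\<close> hold in \<open>H\<close> and hence in
  \<open>X\<close>, so the sets \<open>Y n\<close> of their witnesses are nonempty. They decrease in
  a finite graph and so become stationary; at that stage the required neighbours lie in the set
  itself.\<close>

lemma universal_dense_subset:
  assumes "k \<ge> 2" "k_universal k X"
    and H: "extendible k H" "fo_graph H" "card (pverts H) \<ge> k"
  obtains Y where "Y \<subseteq> pverts X" "Y \<noteq> {}"
    "\<And>y. y \<in> Y \<Longrightarrow> 2 ^ (k - 2) \<le> card {b\<in>Y. (y, b) \<in> parcs X}"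
proof -
  have X: "fo_graph X" using assms(2) by (simp add: k_universal_def)
  define Y where "Y n = {y\<in>pverts X. sat X (\<lambda>_. y) (dense_fm k n)}" for n
  have finY: "finite (Y n)" for n using fo_graphD(1)[OF X] by (simp add: Y_def)
  have ne: "Y n \<noteq> {}" for n
  proof -
    have "FEx 1 (dense_fm k n) \<in> L_ex k" "sentence (FEx 1 (dense_fm k n))"
      using assms(1) dense_fm_L_ex free_vars_dense_fm[of k n]
      by (auto simp: sentence_def intro!: L_ex.ex)
    moreover have "models H (FEx 1 (dense_fm k n))"
      unfolding models_def sat.simps
    proof (intro allI impI)
      fix \<rho> :: "nat \<Rightarrow> 'b" assume "range \<rho> \<subseteq> pverts H"
      then have "\<rho> 1 \<in> pverts H" by blast
      then show "\<exists>a\<in>pverts H. sat H (\<rho>(1 := a)) (dense_fm k n)"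
        using extendible_dense_fm[OF assms(1) H, of "\<rho>(1 := \<rho> 1)"] by (intro bexI) auto
    qed
    ultimately have "models X (FEx 1 (dense_fm k n))"
      using k_universal_imp_preceq[OF assms(2) H(2)] by (simp add: preceq_L_ex_def)
    moreover obtain x where "x \<in> pverts X" using fo_graphD(2)[OF X] by blast
    ultimately have "sat X (\<lambda>_. x) (FEx 1 (dense_fm k n))"
      unfolding models_def by (metis image_subsetI)
    then obtain y where y: "y \<in> pverts X" "sat X ((\<lambda>_. x)(1 := y)) (dense_fm k n)"
      unfolding sat.simps by blast
    have "sat X ((\<lambda>_. x)(1 := y)) (dense_fm k n) \<longleftrightarrow> sat X (\<lambda>_. y) (dense_fm k n)"
      using free_vars_dense_fm by (intro sat_cong) fastforce
    then show ?thesis using y by (auto simp: Y_def)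
  qed
  have Y_Suc: "y \<in> Y (Suc n) \<longleftrightarrow> y \<in> pverts X \<and> (\<exists>\<tau>. \<tau> ` {2..<k} \<subseteq> pverts X \<and>
    (\<forall>B \<subseteq> {2..<k}. \<exists>b\<in>Y n. (y, b) \<in> parcs X \<and> (\<forall>j\<in>{2..<k}. (b, \<tau> j) \<in> parcs X \<longleftrightarrow> j \<in> B)))"
    (is "_ \<longleftrightarrow> _ \<and> (\<exists>\<tau>. _ \<and> (\<forall>B \<subseteq> _. \<exists>b\<in>_. ?nb y \<tau> B b))") for y n
    unfolding Y_def mem_Collect_eq sat_dense_fm_Suc[OF assms(1)] Bex_def by (simp add: conj_ac)
  \<comment> \<open>The condition defining \<open>Y (Suc n)\<close> is monotone in
    \<open>Y n\<close>, and \<open>Y 0\<close> is the whole vertex set.\<close>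
  have mono: "Y (Suc n) \<subseteq> Y n" for n
  proof (induction n)
    case 0
    then show ?case by (auto simp: Y_def)
  next
    case (Suc n)
    show ?case
    proof
      fix y assume "y \<in> Y (Suc (Suc n))"
      then obtain \<tau> where \<tau>: "y \<in> pverts X" "\<tau> ` {2..<k} \<subseteq> pverts X"
        "\<And>B. B \<subseteq> {2..<k} \<Longrightarrow> \<exists>b\<in>Y (Suc n). ?nb y \<tau> B b"
        unfolding Y_Suc[of _ "Suc n"] by blast
      have "\<exists>b\<in>Y n. ?nb y \<tau> B b" if "B \<subseteq> {2..<k}" for B
        using \<tau>(3)[OF that] Suc by blast
      then show "y \<in> Y (Suc n)" unfolding Y_Suc[of _ n] using \<tau>(1,2) by blast
    qed
  qed
  \<comment> \<open>A chain that is never stationary would lose a vertex at every step.\<close>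
  obtain n where n: "Y (Suc n) = Y n"
  proof (rule ccontr)
    assume "\<not> thesis"
    then have "Y (Suc n) \<noteq> Y n" for n using that by blast
    then have "Y (Suc n) \<subset> Y n" for n using mono[of n] by (simp add: psubset_eq)
    then have less: "card (Y (Suc n)) < card (Y n)" for n
      using psubset_card_mono[OF finY[of n]] by blast
    have "card (Y n) + n \<le> card (Y 0)" for n
    proof (induction n)
      case (Suc n)
      then show ?case using less[of n] by simp
    qed simp
    from this[of "Suc (card (Y 0))"] show False by simp
  qed
  have "2 ^ (k - 2) \<le> card {b\<in>Y n. (y, b) \<in> parcs X}" if "y \<in> Y n" for y
  proof -
    have "y \<in> Y (Suc n)" using that n by simp
    then obtain \<tau> where \<tau>: "\<forall>B\<subseteq>{2..<k}. \<exists>b\<in>Y n. ?nb y \<tau> B b" unfolding Y_Suc[of y n] by blast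
    \<comment> \<open>A neighbour realises only one pattern, its trace on \<open>\<tau>\<close>, so
      there are at least as many neighbours as patterns.\<close>
    have "Pow {2..<k} \<subseteq> (\<lambda>b. {j\<in>{2..<k}. (b, \<tau> j) \<in> parcs X}) ` {b\<in>Y n. (y, b) \<in> parcs X}"
    proof
      fix B assume "B \<in> Pow {2..<k}"
      then obtain b where "b \<in> Y n" "(y, b) \<in> parcs X" "\<forall>j\<in>{2..<k}. (b, \<tau> j) \<in> parcs X \<longleftrightarrow> j \<in> B"
        using \<tau> by blast
      with \<open>B \<in> _\<close> show "B \<in> (\<lambda>b. {j\<in>{2..<k}. (b, \<tau> j) \<in> parcs X}) ` {b\<in>Y n. (y, b) \<in> parcs X}"
        by (intro image_eqI[of _ _ b]) auto
    qed
    then have "card (Pow {2..<k}) \<le> card {b\<in>Y n. (y, b) \<in> parcs X}"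
      using finY by (intro surj_card_le) auto
    then show ?thesis by (simp add: card_Pow)
  qed
  then show thesis using that[of "Y n"] ne by (auto simp: Y_def)
qed


section \<open>Sparse graphs and free amalgamation\<close>

text \<open>\<open>parcs\<close> contains each edge in both directions, so \<open>c\<close> bounds
  the average degree of every nonempty induced subgraph.\<close>

definition sparse :: "nat \<Rightarrow> 'a pair_pre_digraph \<Rightarrow> bool" where
  "sparse c X \<longleftrightarrow> (\<forall>S\<subseteq>pverts X. card (parcs X \<inter> S \<times> S) \<le> c * card S)"

text \<open>The degrees within the dense set \<open>Y\<close> add up to the number of arcs inside
  it, which the minimum degree bounds from below and sparsity from above.\<close>

lemma sparse_not_universal:
  assumes "k \<ge> 2" "c < 2 ^ (k - 2)" "sparse c X"
    and H: "extendible k H" "fo_graph H" "card (pverts H) \<ge> k"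
  shows "\<not> k_universal k X"
proof
  assume univ: "k_universal k X"
  then have fin: "finite (pverts X)" using fo_graphD(1) by (auto simp: k_universal_def)
  obtain Y where Y: "Y \<subseteq> pverts X" "Y \<noteq> {}"
    "\<And>y. y \<in> Y \<Longrightarrow> 2 ^ (k - 2) \<le> card {b\<in>Y. (y, b) \<in> parcs X}"
    using universal_dense_subset[OF assms(1) univ H] by blast
  have finY: "finite Y" using Y(1) fin finite_subset by blast
  have "2 ^ (k - 2) * card Y = (\<Sum>y\<in>Y. 2 ^ (k - 2))" by simp
  also have "\<dots> \<le> (\<Sum>y\<in>Y. card {b\<in>Y. (y, b) \<in> parcs X})" using Y(3) by (rule sum_mono)
  also have "\<dots> = card (SIGMA y:Y. {b\<in>Y. (y, b) \<in> parcs X})" using finY by (subst card_SigmaI) auto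
  also have "(SIGMA y:Y. {b\<in>Y. (y, b) \<in> parcs X}) = parcs X \<inter> Y \<times> Y" by auto
  also have "card \<dots> \<le> c * card Y" using assms(3) Y(1) by (simp add: sparse_def)
  finally have "2 ^ (k - 2) \<le> c" using finY Y(2) by (simp add: card_gt_0_iff)
  then show False using assms(2) by simp
qed

section \<open>Hrushovski's predimension and locally closed sets\<close>

definition predim :: "nat \<Rightarrow> 'a pair_pre_digraph \<Rightarrow> 'a set \<Rightarrow> int" where
  "predim c G S = int (c * card S) - int (card (parcs G \<inter> S \<times> S))"

text \<open>Cardinality is modular, while the union can only gain arcs, namely those between
  \<open>A - B\<close> and \<open>B - A\<close>.\<close>

lemma predim_submodular:
  assumes "finite A" "finite B"
  shows "predim c G (A \<union> B) + predim c G (A \<inter> B) \<le> predim c G A + predim c G B"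
proof -
  let ?E = "\<lambda>S. parcs G \<inter> S \<times> S"
  have fin: "finite (?E A)" "finite (?E B)" "finite (?E (A \<union> B))" using assms by auto
  have "card (?E A) + card (?E B) = card (?E A \<union> ?E B) + card (?E A \<inter> ?E B)"
    using fin by (intro card_Un_Int)
  also have "?E A \<inter> ?E B = ?E (A \<inter> B)" by auto
  also have "card (?E A \<union> ?E B) \<le> card (?E (A \<union> B))" using fin by (intro card_mono) auto
  finally have "card (?E A) + card (?E B) \<le> card (?E (A \<union> B)) + card (?E (A \<inter> B))" by simp
  moreover have "c * card A + c * card B = c * card (A \<union> B) + c * card (A \<inter> B)"
    using card_Un_Int[OF assms] by (metis distrib_left)
  ultimately show ?thesis unfolding predim_def by linarith
qed

text \<open>A local form of self-sufficient (strong) sets: only supersets with at most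
  \<open>M\<close> vertices compete, since sparsity of \<open>G\<close> is known only for small
  sets.\<close>

definition closed_set :: "nat \<Rightarrow> nat \<Rightarrow> 'a pair_pre_digraph \<Rightarrow> 'a set \<Rightarrow> bool" where
  "closed_set c M G D \<longleftrightarrow> D \<subseteq> pverts G \<and>
     (\<forall>Z. D \<subseteq> Z \<longrightarrow> Z \<subseteq> pverts G \<longrightarrow> card Z \<le> M \<longrightarrow> predim c G D \<le> predim c G Z)"

text \<open>By submodularity, passing from \<open>D \<inter> T\<close> to \<open>T\<close> raises
  the predimension at least as much as passing from \<open>D\<close> to \<open>D \<union> T\<close>,
  and closedness makes the latter change nonnegative.\<close>

lemma predim_Int_closed_set_le:
  assumes "closed_set c M G D" "finite (pverts G)" "T \<subseteq> pverts G" "card D + card T \<le> M"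
  shows "predim c G (D \<inter> T) \<le> predim c G T"
proof -
  have "D \<subseteq> pverts G" using assms(1) by (simp add: closed_set_def)
  then have "predim c G (D \<union> T) + predim c G (D \<inter> T) \<le> predim c G D + predim c G T"
    using assms(2,3) finite_subset by (intro predim_submodular) blast+
  moreover have "card (D \<union> T) \<le> M" using card_Un_le[of D T] assms(4) by simp
  then have "predim c G D \<le> predim c G (D \<union> T)"
    using assms(1,3) by (simp add: closed_set_def)
  ultimately show ?thesis by simp
qed

definition locally_sparse :: "nat \<Rightarrow> nat \<Rightarrow> 'a pair_pre_digraph \<Rightarrow> bool" where
  "locally_sparse c M G \<longleftrightarrow>
     (\<forall>S\<subseteq>pverts G. card S \<le> M \<longrightarrow> card (parcs G \<inter> S \<times> S) + card S \<le> c * card S)"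

text \<open>
  Local sparsity with a margin gives \<open>card S \<le> predim c G S\<close>, so a set of minimal predimension
  above \<open>P\<close> has bounded size.
\<close>

lemma exists_closed_set:
  assumes "locally_sparse c M G" "P \<subseteq> pverts G" "card P \<le> M"
  obtains D where "P \<subseteq> D" "card D \<le> c * card P" "card D \<le> M" "closed_set c M G D"
proof -
  let ?C = "\<lambda>S. P \<subseteq> S \<and> S \<subseteq> pverts G \<and> card S \<le> M"
  have ge: "int (card S) \<le> predim c G S" if "?C S" for S
  proof -
    have "card (parcs G \<inter> S \<times> S) + card S \<le> c * card S"
      using assms(1) that by (simp add: locally_sparse_def)
    then show ?thesis unfolding predim_def by linarith
  qed
  \<comment> \<open>By \<open>ge\<close> the predimension is nonnegative on all candidates, so
    minimising its \<open>nat\<close> value is faithful.\<close>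
  obtain D where D: "?C D" "\<And>S. ?C S \<Longrightarrow> nat (predim c G D) \<le> nat (predim c G S)"
    using ex_has_least_nat[of ?C P "\<lambda>S. nat (predim c G S)"] assms(2,3) by auto
  have min: "predim c G D \<le> predim c G S" if "?C S" for S
    using D(2)[OF that] ge[OF that] by linarith
  \<comment> \<open>\<open>P\<close> is itself a candidate, so the minimum is at most
    \<open>predim c G P\<close>; by \<open>ge\<close> it is at least \<open>card D\<close>.\<close>
  have "int (card D) \<le> predim c G P" using ge[OF D(1)] min[of P] assms(2,3) by simp
  also have "\<dots> \<le> int (c * card P)" by (simp add: predim_def)
  finally have "card D \<le> c * card P" by linarith
  moreover have "closed_set c M G D" using D(1) min by (auto simp: closed_set_def)
  ultimately show thesis using that D(1) by blast
qed

section \<open>Embeddings and free amalgams\<close>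

definition embeds :: "('a \<Rightarrow> 'b) \<Rightarrow> 'a pair_pre_digraph \<Rightarrow> 'a set \<Rightarrow> 'b pair_pre_digraph \<Rightarrow> bool" where
  "embeds f G D X \<longleftrightarrow> inj_on f D \<and> f ` D \<subseteq> pverts X \<and>
     (\<forall>a\<in>D. \<forall>b\<in>D. (a, b) \<in> parcs G \<longleftrightarrow> (f a, f b) \<in> parcs X)"

lemma embeds_induced_in:
  assumes "embeds f G D X" "induced_in X X'"
  shows "embeds f G D X'"
proof -
  have "f a \<in> pverts X" if "a \<in> D" for a using assms(1) that by (auto simp: embeds_def)
  then have "(f a, f b) \<in> parcs X' \<longleftrightarrow> (f a, f b) \<in> parcs X" if "a \<in> D" "b \<in> D" for a b
    using assms(2) that by (simp add: induced_in_def)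
  then show ?thesis using assms by (simp add: embeds_def induced_in_def subset_iff)
qed

text \<open>\<open>X'\<close> adds to \<open>X\<close> fresh copies of the vertices in
  \<open>D' - D\<close>, joined only as \<open>D'\<close> demands. Closedness of \<open>D\<close>
  ensures that \<open>m\<close> fresh vertices bring at most \<open>c * m\<close> new arcs, which
  keeps the graph sparse.\<close>

lemma free_amalgam:
  fixes X :: "nat pair_pre_digraph"
  assumes G: "fo_graph G" and X: "fo_graph X" "sparse c X"
    and D: "closed_set c M G D" and f: "embeds f G D X"
    and D': "D' \<subseteq> pverts G" "card D + card D' \<le> M"
  obtains X' f' where "fo_graph X'" "sparse c X'" "induced_in X X'" "embeds f' G D' X'"
    "\<forall>a\<in>D \<inter> D'. f' a = f a"
proof -
  note G = fo_graphD[OF G] and Xg = fo_graphD[OF X(1)]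
  have finD': "finite D'" using D'(1) G(1) finite_subset by blast
  obtain g :: "'a \<Rightarrow> nat" where g: "inj_on g D'"
    using finD' finite_imp_inj_to_nat_seg by metis
  \<comment> \<open>Vertices of the form \<open>b + g a\<close> lie beyond all vertices of
    \<open>X\<close>, hence are fresh.\<close>
  obtain b where b: "\<And>x. x \<in> pverts X \<Longrightarrow> x < b"
    using Xg(1) finite_nat_set_iff_bounded by auto
  define f' where "f' a = (if a \<in> D then f a else b + g a)" for a
  define X' where "X' = \<lparr>pverts = pverts X \<union> f' ` D',
    parcs = parcs X \<union> map_prod f' f' ` (parcs G \<inter> D' \<times> D')\<rparr>"
  have fD: "f a \<in> pverts X" if "a \<in> D" for a using f that by (auto simp: embeds_def)
  have f'_D: "f' a \<in> pverts X \<longleftrightarrow> a \<in> D" for a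
    using b[of "b + g a"] fD by (auto simp: f'_def)
  have f'_arc: "(f' a, f' a') \<in> parcs X \<longleftrightarrow> (a, a') \<in> parcs G" if "a \<in> D" "a' \<in> D" for a a'
    using f that by (simp add: embeds_def f'_def)
  have inj: "inj_on f' D'"
  proof (rule inj_onI)
    fix a a' assume aa': "a \<in> D'" "a' \<in> D'" "f' a = f' a'"
    then have "a \<in> D \<longleftrightarrow> a' \<in> D" using f'_D by metis
    then show "a = a'"
      using aa' f inj_onD[OF g] by (auto simp: embeds_def f'_def dest: inj_onD split: if_splits)
  qed
  have "fo_graph X'"
  proof (rule fo_graphI)
    show "parcs X' \<subseteq> pverts X' \<times> pverts X'" using Xg(3) by (auto simp: X'_def)
    show "(v, u) \<in> parcs X'" if "(u, v) \<in> parcs X'" for u v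
      using that Xg(4) G(4) by (auto simp: X'_def)
    show "(u, u) \<notin> parcs X'" for u
      using Xg(5) G(5) inj by (auto simp: X'_def dest: inj_onD)
  qed (use Xg(1,2) finD' in \<open>auto simp: X'_def\<close>)
  moreover have "sparse c X'"
    unfolding sparse_def
  proof (intro allI impI)
    fix S assume S: "S \<subseteq> pverts X'"
    let ?E = "\<lambda>G S. parcs G \<inter> S \<times> S"
    define T where "T = {a\<in>D'. f' a \<in> S}"
    have T: "T \<subseteq> D'" "finite T" using finD' by (auto simp: T_def)
    have "card D + card T \<le> M" using card_mono[OF finD' T(1)] D'(2) by simp
    \<comment> \<open>In terms of arcs: \<open>T\<close> has at most \<open>c * card (T - D)\<close>
      more of them than \<open>D \<inter> T\<close>.\<close>
    then have "predim c G (D \<inter> T) \<le> predim c G T"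
      using predim_Int_closed_set_le[OF D G(1)] T(1) D'(1) by blast
    moreover have "card T = card (T - D) + card (D \<inter> T)"
      using card_Diff_subset_Int[of T D] card_mono[of T "D \<inter> T"] T(2) by (simp add: Int_commute)
    ultimately have new: "card (?E G T) \<le> c * card (T - D) + card (?E G (D \<inter> T))"
      by (simp add: predim_def algebra_simps flip: of_nat_mult of_nat_add)
    \<comment> \<open>Arcs copied from inside \<open>D\<close> are already arcs of \<open>X\<close>,
      so only arcs of \<open>T\<close> that leave \<open>D \<inter> T\<close> count as new.\<close>
    have "?E X' S \<subseteq> ?E X (S \<inter> pverts X) \<union> map_prod f' f' ` (?E G T - ?E G (D \<inter> T))"
      using Xg(3) f'_arc by (fastforce simp: X'_def T_def)
    then have "card (?E X' S) \<le> card (?E X (S \<inter> pverts X)) + card (?E G T - ?E G (D \<inter> T))"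
    proof (rule order_trans[OF card_mono[rotated]])
      show "finite (?E X (S \<inter> pverts X) \<union> map_prod f' f' ` (?E G T - ?E G (D \<inter> T)))"
        using Xg(1) T(2) by simp
      show "card (?E X (S \<inter> pverts X) \<union> map_prod f' f' ` (?E G T - ?E G (D \<inter> T)))
          \<le> card (?E X (S \<inter> pverts X)) + card (?E G T - ?E G (D \<inter> T))"
        using T(2) by (intro order_trans[OF card_Un_le] add_left_mono card_image_le) simp
    qed
    also have "card (?E G T - ?E G (D \<inter> T)) = card (?E G T) - card (?E G (D \<inter> T))"
      using T(2) by (intro card_Diff_subset) auto
    also have "\<dots> \<le> c * card (T - D)" using new by simp
    also have "card (?E X (S \<inter> pverts X)) \<le> c * card (S \<inter> pverts X)"
      using X(2) by (simp add: sparse_def)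
    also have "c * card (S \<inter> pverts X) + c * card (T - D) = c * card S"
    proof -
      \<comment> \<open>\<open>S\<close> splits into its old vertices and the fresh copies of
        \<open>T - D\<close>; vertices of \<open>T \<inter> D\<close> are counted as old.\<close>
      have "S = (S \<inter> pverts X) \<union> f' ` (T - D)"
        using S f'_D by (auto simp: X'_def T_def)
      moreover have "(S \<inter> pverts X) \<inter> f' ` (T - D) = {}" using f'_D by auto
      moreover have "card (f' ` (T - D)) = card (T - D)"
        using inj T(1) by (intro card_image) (auto intro: inj_on_subset)
      ultimately have "card S = card (S \<inter> pverts X) + card (T - D)"
        using card_Un_disjoint[of "S \<inter> pverts X" "f' ` (T - D)"] Xg(1) T(2) by simp
      then show ?thesis by (simp add: distrib_left)
    qed
    finally show "card (?E X' S) \<le> c * card S" by simp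
  qed
  moreover have "induced_in X X'"
    using Xg(3) f'_arc f'_D by (auto simp: induced_in_def X'_def)
  moreover have "embeds f' G D' X'"
    unfolding embeds_def
  proof (intro conjI ballI inj)
    show "f' ` D' \<subseteq> pverts X'" by (simp add: X'_def)
    fix a a' assume aa': "a \<in> D'" "a' \<in> D'"
    show "(a, a') \<in> parcs G \<longleftrightarrow> (f' a, f' a') \<in> parcs X'"
    proof
      assume "(f' a, f' a') \<in> parcs X'"
      then consider "(f' a, f' a') \<in> parcs X"
        | u v where "(u, v) \<in> parcs G" "u \<in> D'" "v \<in> D'" "f' a = f' u" "f' a' = f' v"
        by (auto simp: X'_def)
      then show "(a, a') \<in> parcs G"
      proof cases
        case 1
        \<comment> \<open>\<open>f'\<close> reaches old vertices only from \<open>D\<close>, and on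
          \<open>D\<close> it is the embedding \<open>f\<close>.\<close>
        then have "a \<in> D" "a' \<in> D" using Xg(3) f'_D by auto
        then show ?thesis using 1 f'_arc by simp
      next
        case 2
        then have "a = u" "a' = v" using aa' inj by (auto dest: inj_onD)
        then show ?thesis using 2(1) by simp
      qed
    qed (use aa' in \<open>auto simp: X'_def\<close>)
  qed
  moreover have "\<forall>a\<in>D \<inter> D'. f' a = f a" by (simp add: f'_def)
  ultimately show thesis by (rule that)
qed

text \<open>The induction carries along a small closed set \<open>D\<close> that contains the
  current values of the variables, and a copy of \<open>D\<close> in \<open>X\<close>. The bound on
  \<open>M\<close> leaves room for two such sets at a time, as amalgamation demands.\<close>

lemma sparse_extension_sat:
  fixes X :: "nat pair_pre_digraph"
  assumes G: "fo_graph G" "locally_sparse c M G" "2 * c * K \<le> M" and "c > 0"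
    and \<phi>: "\<phi> \<in> L_ex K"
    and D: "\<rho> ` {1..K} \<subseteq> D" "closed_set c M G D" "2 * card D \<le> M"
    and X: "fo_graph X" "sparse c X" "embeds f G D X"
    and "sat G \<rho> \<phi>"
  obtains X' where "fo_graph X'" "sparse c X'" "induced_in X X'" "sat X' (f \<circ> \<rho>) \<phi>"
proof -
  have "\<exists>X'. fo_graph X' \<and> sparse c X' \<and> induced_in X X' \<and> sat X' (f \<circ> \<rho>) \<phi>"
    using \<phi> D X \<open>sat G \<rho> \<phi>\<close>
  proof (induction arbitrary: \<rho> D X f rule: L_ex.induct)
    case (atom \<phi>)
    obtain i j where ij: "i \<in> {1..K}" "j \<in> {1..K}" "\<phi> = FEq i j \<or> \<phi> = FEdge i j"
      using atom(1,2) by (elim atomic_fm_cases)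
    then have "\<rho> i \<in> D" "\<rho> j \<in> D" using atom.prems(1) by auto
    then have "sat X (f \<circ> \<rho>) \<phi>" using ij(3) atom.prems by (auto simp: embeds_def dest: inj_onD)
    then show ?case using atom.prems induced_in_refl[OF fo_graphD(3)] by blast
  next
    case (neg_atom \<phi>)
    obtain i j where ij: "i \<in> {1..K}" "j \<in> {1..K}" "\<phi> = FEq i j \<or> \<phi> = FEdge i j"
      using neg_atom(1,2) by (elim atomic_fm_cases)
    then have "\<rho> i \<in> D" "\<rho> j \<in> D" using neg_atom.prems(1) by auto
    then have "sat X (f \<circ> \<rho>) (FNeg \<phi>)"
      using ij(3) neg_atom.prems by (auto simp: embeds_def dest: inj_onD)
    then show ?case using neg_atom.prems induced_in_refl[OF fo_graphD(3)] by blast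
  next
    case (conj \<phi> \<psi>)
    have sat: "sat G \<rho> \<phi>" "sat G \<rho> \<psi>" using conj.prems(7) by auto
    have f: "(f \<circ> \<rho>) ` {1..K} \<subseteq> pverts X"
      using conj.prems(1,6) by (auto simp: embeds_def)
    obtain X1 where X1: "fo_graph X1" "sparse c X1" "induced_in X X1" "sat X1 (f \<circ> \<rho>) \<phi>"
      using conj.IH(1)[OF conj.prems(1-6) sat(1)] by blast
    \<comment> \<open>The second conjunct is realised on top of \<open>X1\<close>; the first
      survives since \<open>X1\<close> is induced in \<open>X2\<close>.\<close>
    then obtain X2 where X2: "fo_graph X2" "sparse c X2" "induced_in X1 X2" "sat X2 (f \<circ> \<rho>) \<psi>"
      using conj.IH(2)[OF conj.prems(1-3) X1(1,2) embeds_induced_in[OF conj.prems(6) X1(3)] sat(2)]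
      by blast
    have "sat X2 (f \<circ> \<rho>) \<phi>"
      using sat_induced_in[OF conj.hyps(1) X2(3) _ X1(4)] f X1(3) by (auto simp: induced_in_def)
    then show ?case
      unfolding sat.simps using X2 induced_in_trans[OF X1(3) X2(3)] by blast
  next
    case (disj \<phi> \<psi>)
    from disj.prems(7) consider "sat G \<rho> \<phi>" | "sat G \<rho> \<psi>" by auto
    then show ?case
      unfolding sat.simps
      using disj.IH(1)[OF disj.prems(1-6)] disj.IH(2)[OF disj.prems(1-6)] by cases blast+
  next
    case (ex \<phi> i)
    obtain a where a: "a \<in> pverts G" "sat G (\<rho>(i := a)) \<phi>" using ex.prems(7) by auto
    let ?P = "(\<rho>(i := a)) ` {1..K}"
    have P: "?P \<subseteq> pverts G" using a(1) ex.prems(1,2) by (auto simp: closed_set_def)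
    have card_P: "card ?P \<le> K" using card_image_le[of "{1..K}" "\<rho>(i := a)"] by simp
    have "1 * K \<le> 2 * c * K" using \<open>c > 0\<close> by (intro mult_right_mono) auto
    then have card_P_M: "card ?P \<le> M" using card_P G(3) by linarith
    \<comment> \<open>The new closed set is built around the at most \<open>K\<close> current
      values, not around \<open>D\<close>, so its size stays bounded at every quantifier depth. The
      old value of variable \<open>i\<close> is dropped.\<close>
    obtain D' where D': "?P \<subseteq> D'" "card D' \<le> c * card ?P" "card D' \<le> M" "closed_set c M G D'"
      by (rule exists_closed_set[OF G(2) P card_P_M])
    have D'_M: "2 * card D' \<le> M"
      using D'(2) mult_le_mono2[OF card_P, of c] G(3) by linarith
    then have sum: "card D + card D' \<le> M" using ex.prems(3) by simp
    have D'_G: "D' \<subseteq> pverts G" using D'(4) by (simp add: closed_set_def)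
    obtain X1 f1 where X1: "fo_graph X1" "sparse c X1" "induced_in X X1" "embeds f1 G D' X1"
      and f1: "\<forall>a\<in>D \<inter> D'. f1 a = f a"
      by (rule free_amalgam[OF G(1) ex.prems(4,5,2,6) D'_G sum])
    obtain X2 where X2: "fo_graph X2" "sparse c X2" "induced_in X1 X2"
      and sat: "sat X2 (f1 \<circ> \<rho>(i := a)) \<phi>"
      using ex.IH[OF D'(1,4) D'_M X1(1,2,4) a(2)] by blast
    \<comment> \<open>Amalgamation keeps \<open>f\<close> on \<open>D \<inter> D'\<close>, which
      contains the values of all other variables.\<close>
    have "f1 (\<rho> j) = f (\<rho> j)" if "j \<in> {1..K}" "j \<noteq> i" for j
    proof -
      have "(\<rho>(i := a)) j \<in> D'" using that(1) D'(1) by blast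
      then have "\<rho> j \<in> D'" using that(2) by simp
      moreover have "\<rho> j \<in> D" using that ex.prems(1) by blast
      ultimately show ?thesis using f1 by blast
    qed
    then have "sat X2 ((f \<circ> \<rho>)(i := f1 a)) \<phi>"
      using sat by (subst sat_cong_L_ex[OF ex.hyps(1), of _ "f1 \<circ> \<rho>(i := a)"]) auto
    moreover have "a \<in> D'" using D'(1) ex.hyps(2) by auto
    then have "f1 a \<in> pverts X2" using X1(4) X2(3) by (auto simp: embeds_def induced_in_def)
    ultimately have "sat X2 (f \<circ> \<rho>) (FEx i \<phi>)" unfolding sat.simps by blast
    then show ?case using X2 induced_in_trans[OF X1(3) X2(3)] by blast
  qed
  then show thesis using that by blast
qed


section \<open>Random graphs\<close>

text \<open>Independence in counting form: membership in \<open>Q\<close> ignores the colours on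
  \<open>F\<close>, so a colouring in \<open>Q\<close> is a colouring in \<open>Q\<close> equal to
  \<open>t\<close> on \<open>F\<close> together with a free choice of colours on
  \<open>F\<close>.\<close>

lemma card_fixed_coords:
  assumes "finite E" "F \<subseteq> E" "t \<in> F \<rightarrow> {..<q}" "Q \<subseteq> E \<rightarrow>\<^sub>E {..<q::nat}"
    and indep: "\<And>\<chi> \<chi>'. \<chi> \<in> Q \<Longrightarrow> \<chi>' \<in> E \<rightarrow>\<^sub>E {..<q} \<Longrightarrow> (\<And>e. e \<in> E - F \<Longrightarrow> \<chi> e = \<chi>' e) \<Longrightarrow> \<chi>' \<in> Q"
  shows "card {\<chi>\<in>Q. \<forall>e\<in>F. \<chi> e = t e} * q ^ card F = card Q"
proof -
  let ?Q = "{\<chi>\<in>Q. \<forall>e\<in>F. \<chi> e = t e}"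
  define join :: "('a \<Rightarrow> nat) \<Rightarrow> ('a \<Rightarrow> nat) \<Rightarrow> 'a \<Rightarrow> nat"
    where "join \<chi> g = (\<lambda>e. if e \<in> F then g e else \<chi> e)" for \<chi> g
  have join: "join \<chi> g \<in> Q" if "\<chi> \<in> Q" "g \<in> F \<rightarrow> {..<q}" for \<chi> g
  proof (rule indep[OF that(1)])
    have \<chi>: "\<chi> \<in> E \<rightarrow>\<^sub>E {..<q}" using that(1) assms(4) by blast
    show "join \<chi> g \<in> E \<rightarrow>\<^sub>E {..<q}"
    proof (rule PiE_I)
      show "join \<chi> g e \<in> {..<q}" if "e \<in> E" for e
        using PiE_mem[OF \<chi> that] \<open>g \<in> F \<rightarrow> {..<q}\<close> by (auto simp: join_def)
      show "join \<chi> g e = undefined" if "e \<notin> E" for e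
        using PiE_arb[OF \<chi> that] assms(2) that by (auto simp: join_def)
    qed
  qed (simp add: join_def)
  have "bij_betw (\<lambda>(\<chi>, g). join \<chi> g) (?Q \<times> (F \<rightarrow>\<^sub>E {..<q})) Q"
  \<comment> \<open>The inverse resets the colours on \<open>F\<close> to \<open>t\<close> and
    records what they were.\<close>
  proof (rule bij_betwI[where g = "\<lambda>\<chi>. (join \<chi> t, restrict \<chi> F)"])
    show "(\<lambda>(\<chi>, g). join \<chi> g) \<in> ?Q \<times> (F \<rightarrow>\<^sub>E {..<q}) \<rightarrow> Q"
      using join by (auto simp: PiE_def)
    show "(\<lambda>\<chi>. (join \<chi> t, restrict \<chi> F)) \<in> Q \<rightarrow> ?Q \<times> (F \<rightarrow>\<^sub>E {..<q})"
    proof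
      fix \<chi> assume \<chi>: "\<chi> \<in> Q"
      then have "\<chi> e \<in> {..<q}" if "e \<in> F" for e using assms(2,4) that by (blast dest: PiE_mem)
      then have "restrict \<chi> F \<in> F \<rightarrow>\<^sub>E {..<q}" by simp
      then show "(join \<chi> t, restrict \<chi> F) \<in> ?Q \<times> (F \<rightarrow>\<^sub>E {..<q})"
        using join[OF \<chi> assms(3)] by (simp add: join_def)
    qed
  next
    fix x assume x: "x \<in> ?Q \<times> (F \<rightarrow>\<^sub>E {..<q})"
    obtain \<chi> g where [simp]: "x = (\<chi>, g)" by (cases x)
    have "\<forall>e\<in>F. \<chi> e = t e" "g \<in> F \<rightarrow>\<^sub>E {..<q}" using x by auto
    then have "join (join \<chi> g) t = \<chi>" "restrict (join \<chi> g) F = g"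
      by (auto simp: join_def fun_eq_iff restrict_def dest: PiE_arb)
    then show "(join ((\<lambda>(\<chi>, g). join \<chi> g) x) t, restrict ((\<lambda>(\<chi>, g). join \<chi> g) x) F) = x"
      by simp
  next
    fix \<chi>
    show "(\<lambda>(\<chi>, g). join \<chi> g) (join \<chi> t, restrict \<chi> F) = \<chi>"
      by (simp add: join_def fun_eq_iff)
  qed
  then have "card (?Q \<times> (F \<rightarrow>\<^sub>E {..<q})) = card Q" by (rule bij_betw_same_card)
  moreover have "finite F" using assms(1,2) finite_subset by blast
  ultimately show ?thesis by (simp add: card_cartesian_product card_PiE)
qed

text \<open>Disjoint blocks are independent, and each differs from \<open>t\<close> somewhere with
  probability \<open>1 - 1 / q ^ h\<close>. Denominators are cleared to stay within
  \<open>nat\<close>.\<close>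

lemma card_avoid_blocks:
  assumes "finite E" "t \<in> E \<rightarrow> {..<q}" "finite I"
    and "\<And>v. v \<in> I \<Longrightarrow> C v \<subseteq> E \<and> card (C v) = h"
    and "\<And>v w. v \<in> I \<Longrightarrow> w \<in> I \<Longrightarrow> v \<noteq> w \<Longrightarrow> C v \<inter> C w = {}"
  shows "card {\<chi> \<in> E \<rightarrow>\<^sub>E {..<q::nat}. \<forall>v\<in>I. \<exists>e\<in>C v. \<chi> e \<noteq> t e} * (q ^ h) ^ card I =
    (q ^ h - 1) ^ card I * card (E \<rightarrow>\<^sub>E {..<q})"
  using assms(3-)
proof (induction I)
  case (insert v I)
  let ?Q = "\<lambda>I. {\<chi> \<in> E \<rightarrow>\<^sub>E {..<q}. \<forall>v\<in>I. \<exists>e\<in>C v. \<chi> e \<noteq> t e}"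
  let ?F = "{\<chi>\<in>?Q I. \<forall>e\<in>C v. \<chi> e = t e}"
  have fin: "finite (?Q I)" using assms(1) by (simp add: finite_PiE)
  have C: "C v \<subseteq> E" "card (C v) = h" using insert.prems(1) by auto
  \<comment> \<open>Among the colourings that avoid \<open>t\<close> on the earlier blocks, a
    fraction \<open>1 / q ^ h\<close> agrees with \<open>t\<close> on \<open>C v\<close>: the
    earlier blocks are disjoint from \<open>C v\<close>.\<close>
  have "card ?F * q ^ card (C v) = card (?Q I)"
  proof (rule card_fixed_coords[OF assms(1) C(1)])
    show "t \<in> C v \<rightarrow> {..<q}" using assms(2) C(1) by auto
    fix \<chi> \<chi>' assume \<chi>: "\<chi> \<in> ?Q I" "\<chi>' \<in> E \<rightarrow>\<^sub>E {..<q}" "\<And>e. e \<in> E - C v \<Longrightarrow> \<chi> e = \<chi>' e"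
    have "\<exists>e\<in>C w. \<chi>' e \<noteq> t e" if w: "w \<in> I" for w
    proof -
      obtain e where e: "e \<in> C w" "\<chi> e \<noteq> t e" using \<chi>(1) w by blast
      have "C w \<subseteq> E" using insert.prems(1)[of w] w by simp
      moreover have "C v \<inter> C w = {}"
        by (rule insert.prems(2)) (use w insert.hyps(2) in auto)
      ultimately have "e \<in> E - C v" using e(1) by blast
      then show ?thesis using e \<chi>(3) by metis
    qed
    then show "\<chi>' \<in> ?Q I" using \<chi>(2) by blast
  qed auto
  then have F: "card ?F * q ^ h = card (?Q I)" using C(2) by simp
  have "?Q (insert v I) = ?Q I - ?F" by auto
  moreover have "finite ?F" using fin by (rule rev_finite_subset) auto
  then have "card (?Q I - ?F) = card (?Q I) - card ?F" by (rule card_Diff_subset) auto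
  ultimately have "card (?Q (insert v I)) = card (?Q I) - card ?F" by (rule trans[OF arg_cong])
  then have "card (?Q (insert v I)) * q ^ h = card (?Q I) * q ^ h - card (?Q I)"
    using F by (simp add: diff_mult_distrib)
  also have "\<dots> = (q ^ h - 1) * card (?Q I)" by (simp add: diff_mult_distrib mult.commute)
  finally have step: "card (?Q (insert v I)) * q ^ h = (q ^ h - 1) * card (?Q I)" .
  have "card (?Q (insert v I)) * (q ^ h) ^ card (insert v I) =
      card (?Q (insert v I)) * q ^ h * (q ^ h) ^ card I"
    by (simp only: card_insert_disjoint[OF insert.hyps] power_Suc mult.assoc)
  also have "\<dots> = (q ^ h - 1) * (card (?Q I) * (q ^ h) ^ card I)"
    by (simp only: step mult.assoc)
  also have "card (?Q I) * (q ^ h) ^ card I = (q ^ h - 1) ^ card I * card (E \<rightarrow>\<^sub>E {..<q})"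
    using insert by simp
  finally show ?case by (simp only: card_insert_disjoint[OF insert.hyps] power_Suc mult.assoc)
qed simp

section \<open>Graphs from colourings of pairs, and the probability of their defects\<close>

definition pairs :: "nat \<Rightarrow> (nat \<times> nat) set" where
  "pairs n = {(u, v). u < v \<and> v < n}"

lemma finite_pairs: "finite (pairs n)"
  by (rule finite_subset[of _ "{..<n} \<times> {..<n}"]) (auto simp: pairs_def)

text \<open>Unordered pairs are coded in increasing order, so that both directions of an edge read
  the same colour.\<close>

definition upair :: "nat \<Rightarrow> nat \<Rightarrow> nat \<times> nat" where
  "upair u v = (min u v, max u v)"

text \<open>An edge is a pair of colour \<open>0\<close>: under a uniform colouring it has probability \<open>1/q\<close>.\<close>

definition colour_graph :: "nat \<Rightarrow> (nat \<times> nat \<Rightarrow> nat) \<Rightarrow> nat pair_pre_digraph" where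
  "colour_graph n \<chi> = \<lparr>pverts = {..<n},
     parcs = {(u, v). u < n \<and> v < n \<and> u \<noteq> v \<and> \<chi> (upair u v) = 0}\<rparr>"

lemma upair_commute: "upair u v = upair v u"
  by (simp add: upair_def min.commute max.commute)

lemma fo_graph_colour_graph: "n > 0 \<Longrightarrow> fo_graph (colour_graph n \<chi>)"
proof (rule fo_graphI)
  show "(v, u) \<in> parcs (colour_graph n \<chi>)" if "(u, v) \<in> parcs (colour_graph n \<chi>)" for u v
    using that upair_commute[of u v] by (simp add: colour_graph_def)
qed (auto simp: colour_graph_def)

definition bad_extension :: "nat \<Rightarrow> nat \<Rightarrow> nat set \<Rightarrow> nat set \<Rightarrow> (nat \<times> nat \<Rightarrow> nat) set" where
  "bad_extension n q A B = {\<chi> \<in> pairs n \<rightarrow>\<^sub>E {..<q}.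
     \<forall>v\<in>{..<n} - A. \<not> (\<forall>a\<in>A. \<chi> (upair v a) = 0 \<longleftrightarrow> a \<in> B)}"

text \<open>Different vertices outside \<open>A\<close> use disjoint blocks of pairs, so their
  failures to realise the pattern are independent.\<close>

lemma card_bad_extension_le:
  assumes "q \<ge> 2" "A \<subseteq> {..<n}" "B \<subseteq> A"
  shows "real (card (bad_extension n q A B)) \<le>
    (1 - 1 / real q ^ card A) ^ (n - card A) * card (pairs n \<rightarrow>\<^sub>E {..<q})"
proof -
  let ?h = "card A" and ?\<Omega> = "pairs n \<rightarrow>\<^sub>E {..<q}"
  define I where "I = {..<n} - A"
  define C where "C v = upair v ` A" for v
  \<comment> \<open>A non-edge may have any colour but \<open>0\<close>; asking for colour
    \<open>1\<close>, available as \<open>q \<ge> 2\<close>, only makes success rarer, so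
    \<open>?Q\<close> contains all bad colourings.\<close>
  define t :: "nat \<times> nat \<Rightarrow> nat" where
    "t e = (if fst e \<in> B \<or> snd e \<in> B then 0 else 1)" for e
  let ?Q = "{\<chi> \<in> ?\<Omega>. \<forall>v\<in>I. \<exists>e\<in>C v. \<chi> e \<noteq> t e}"
  have finA: "finite A" using assms(2) finite_subset by blast
  have t: "t (upair v a) = (if a \<in> B then 0 else 1)" if "v \<in> I" for v a
    using that assms(3) by (auto simp: t_def upair_def I_def min_def max_def)
  \<comment> \<open>One end lies outside \<open>A\<close> and the other inside, so the unordered
    pair determines both.\<close>
  have upair_eq: "v = w \<and> a = b" if "v \<in> I" "w \<in> I" "a \<in> A" "b \<in> A" "upair v a = upair w b"
    for v w a b
    using that by (auto simp: upair_def I_def min_def max_def split: if_splits)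
  have C: "C v \<subseteq> pairs n \<and> card (C v) = ?h" if v: "v \<in> I" for v
  proof
    show "C v \<subseteq> pairs n"
    proof
      fix e assume "e \<in> C v"
      then obtain a where a: "a \<in> A" "e = upair v a" by (auto simp: C_def)
      then have "a \<noteq> v" "a < n" "v < n" using v assms(2) by (auto simp: I_def)
      then show "e \<in> pairs n" using a by (auto simp: pairs_def upair_def)
    qed
    show "card (C v) = ?h"
      unfolding C_def using upair_eq[OF v v] by (intro card_image inj_onI) simp
  qed
  have "card I = n - ?h" using assms(2) finA by (simp add: I_def card_Diff_subset)
  then have *: "card ?Q * (q ^ ?h) ^ (n - ?h) = (q ^ ?h - 1) ^ (n - ?h) * card ?\<Omega>"
    using card_avoid_blocks[of "pairs n" t q I C ?h] C upair_eq finite_pairs assms(1)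
    by (fastforce simp: t_def I_def C_def)
  have "bad_extension n q A B \<subseteq> ?Q"
  proof
    fix \<chi> assume \<chi>: "\<chi> \<in> bad_extension n q A B"
    have "\<exists>e\<in>C v. \<chi> e \<noteq> t e" if v: "v \<in> I" for v
    proof -
      obtain a where "a \<in> A" "\<not> (\<chi> (upair v a) = 0 \<longleftrightarrow> a \<in> B)"
      proof -
        have "\<forall>v\<in>{..<n} - A. \<not> (\<forall>a\<in>A. \<chi> (upair v a) = 0 \<longleftrightarrow> a \<in> B)"
          using \<chi> by (simp add: bad_extension_def)
        then show thesis using v that unfolding I_def by blast
      qed
      then show ?thesis
        using t[OF v, of a] by (intro bexI[of _ "upair v a"]) (auto simp: C_def split: if_splits)
    qed
    then show "\<chi> \<in> ?Q" using \<chi> by (auto simp: bad_extension_def)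
  qed
  then have "card (bad_extension n q A B) \<le> card ?Q"
    using finite_pairs by (intro card_mono) (simp_all add: finite_PiE)
  then have "real (card (bad_extension n q A B)) \<le> real (card ?Q)" by simp
  also have "\<dots> = real ((q ^ ?h - 1) ^ (n - ?h) * card ?\<Omega>) / real (q ^ ?h) ^ (n - ?h)"
    unfolding *[symmetric] using assms(1) by (simp add: field_simps)
  also have "\<dots> = ((real q ^ ?h - 1) / real q ^ ?h) ^ (n - ?h) * card ?\<Omega>"
    using assms(1) by (simp add: of_nat_diff power_divide)
  also have "(real q ^ ?h - 1) / real q ^ ?h = 1 - 1 / real q ^ ?h"
    using assms(1) by (simp add: diff_divide_distrib)
  finally show ?thesis .
qed

lemma card_monochromatic:
  assumes "F \<subseteq> pairs n" "q > 0"
  shows "real (card {\<chi> \<in> pairs n \<rightarrow>\<^sub>E {..<q}. \<forall>e\<in>F. \<chi> e = 0}) =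
    card (pairs n \<rightarrow>\<^sub>E {..<q}) / real q ^ card F"
proof -
  have "card {\<chi> \<in> pairs n \<rightarrow>\<^sub>E {..<q}. \<forall>e\<in>F. \<chi> e = 0} * q ^ card F = card (pairs n \<rightarrow>\<^sub>E {..<q})"
    using card_fixed_coords[of "pairs n" F "\<lambda>_. 0" q "pairs n \<rightarrow>\<^sub>E {..<q}"] assms finite_pairs
    by simp
  then show ?thesis
    using assms(2) by (simp add: field_simps flip: of_nat_power of_nat_mult)
qed

section \<open>The union bound and the choice of parameters\<close>

lemma binomial_le_power: "n choose s \<le> n ^ s"
  by (cases "s \<le> n") (simp_all add: binomial_le_pow binomial_eq_0)

text \<open>A union bound: the two parts of \<open>small\<close> bound the probability that some
  pattern over \<open>h\<close> points is unrealised and that some set of \<open>s \<le> M\<close>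
  vertices spans at least \<open>c * s\<close> edges.\<close>

lemma exists_colouring:
  fixes n q h c M :: nat
  assumes q: "q \<ge> 2"
    and small: "real n ^ h * 2 ^ h * (1 - 1 / real q ^ h) ^ (n - h) +
      (\<Sum>s=1..M. real n ^ s * 2 ^ (s * s) / real q ^ (c * s)) < 1"
  shows "\<exists>\<chi> :: nat \<times> nat \<Rightarrow> nat.
    (\<forall>A B. A \<subseteq> {..<n} \<longrightarrow> card A = h \<longrightarrow> B \<subseteq> A \<longrightarrow>
      (\<exists>v\<in>{..<n} - A. \<forall>a\<in>A. \<chi> (upair v a) = 0 \<longleftrightarrow> a \<in> B)) \<and>
    (\<forall>S. S \<subseteq> {..<n} \<longrightarrow> S \<noteq> {} \<longrightarrow> card S \<le> M \<longrightarrow>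
      card {e \<in> pairs n \<inter> S \<times> S. \<chi> e = 0} < c * card S)"
proof -
  let ?\<Omega> = "pairs n \<rightarrow>\<^sub>E {..<q}"
  define I where "I = (SIGMA A:{A. A \<subseteq> {..<n} \<and> card A = h}. Pow A)"
  \<comment> \<open>Exactly \<open>c * s\<close> pairs are enough to record: a set with more edges
    contains such an \<open>F\<close>.\<close>
  define J where "J s = (SIGMA S:{S. S \<subseteq> {..<n} \<and> card S = s}.
    {F. F \<subseteq> pairs n \<inter> S \<times> S \<and> card F = c * s})" for s
  define mono where "mono F = {\<chi> \<in> ?\<Omega>. \<forall>e\<in>F. \<chi> e = 0}" for F
  let ?bad = "(\<Union>(A, B)\<in>I. bad_extension n q A B) \<union> (\<Union>s\<in>{1..M}. \<Union>(S, F)\<in>J s. mono F)"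
  have fin\<Omega>: "finite ?\<Omega>" using finite_pairs by (simp add: finite_PiE)
  have pos: "card ?\<Omega> > 0" using q finite_pairs by (simp add: card_PiE)
  have finI: "finite I"
    unfolding I_def by (intro finite_SigmaI) (auto intro: finite_subset)
  have finJ: "finite (J s)" for s
    unfolding J_def using finite_pairs by (intro finite_SigmaI) auto
  have cardI: "card I \<le> n ^ h * 2 ^ h"
  proof -
    have "card I = (\<Sum>A | A \<subseteq> {..<n} \<and> card A = h. card (Pow A))"
      unfolding I_def by (intro card_SigmaI) (auto intro: finite_subset)
    also have "\<dots> = (\<Sum>A | A \<subseteq> {..<n} \<and> card A = h. 2 ^ h)"
      by (intro sum.cong refl) (auto simp: card_Pow finite_subset[OF _ finite_lessThan])
    also have "\<dots> = (n choose h) * 2 ^ h" by (simp add: n_subsets)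
    finally show ?thesis using binomial_le_power by simp
  qed
  have cardJ: "card (J s) \<le> n ^ s * 2 ^ (s * s)" for s
  proof -
    have "card (J s) \<le> (\<Sum>S | S \<subseteq> {..<n} \<and> card S = s.
        card {F. F \<subseteq> pairs n \<inter> S \<times> S \<and> card F = c * s})"
      unfolding J_def using finite_pairs by (subst card_SigmaI) auto
    also have "\<dots> \<le> (\<Sum>S | S \<subseteq> {..<n} \<and> card S = s. 2 ^ (s * s))"
    proof (rule sum_mono)
      fix S assume S: "S \<in> {S. S \<subseteq> {..<n} \<and> card S = s}"
      then have finS: "finite S" using finite_subset by blast
      have "card {F. F \<subseteq> pairs n \<inter> S \<times> S \<and> card F = c * s} \<le> card (Pow (S \<times> S))"
        using finS by (intro card_mono) auto
      then show "card {F. F \<subseteq> pairs n \<inter> S \<times> S \<and> card F = c * s} \<le> 2 ^ (s * s)"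
        using S finS by (simp add: card_Pow card_cartesian_product)
    qed
    also have "\<dots> = (n choose s) * 2 ^ (s * s)" by (simp add: n_subsets)
    finally show ?thesis using binomial_le_power le_trans by (metis mult_le_mono1)
  qed
  have "card ?bad \<le> (\<Sum>(A, B)\<in>I. card (bad_extension n q A B)) +
      (\<Sum>s=1..M. \<Sum>(S, F)\<in>J s. card (mono F))"
  proof (intro order_trans[OF card_Un_le] add_mono)
    show "card (\<Union>(A, B)\<in>I. bad_extension n q A B) \<le> (\<Sum>(A, B)\<in>I. card (bad_extension n q A B))"
      using card_UN_le[OF finI, of "\<lambda>(A, B). bad_extension n q A B"] by (simp add: case_prod_unfold)
    have "card (\<Union>(S, F)\<in>J s. mono F) \<le> (\<Sum>(S, F)\<in>J s. card (mono F))" for s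
      using card_UN_le[OF finJ[of s], of "\<lambda>(S, F). mono F"] by (simp add: case_prod_unfold)
    then show "card (\<Union>s\<in>{1..M}. \<Union>(S, F)\<in>J s. mono F) \<le> (\<Sum>s=1..M. \<Sum>(S, F)\<in>J s. card (mono F))"
      by (intro order_trans[OF card_UN_le] sum_mono) (auto simp: finJ split: prod.split)
  qed
  then have "real (card ?bad) \<le> (\<Sum>(A, B)\<in>I. real (card (bad_extension n q A B))) +
      (\<Sum>s=1..M. \<Sum>(S, F)\<in>J s. real (card (mono F)))"
    by (simp add: case_prod_unfold flip: of_nat_sum of_nat_add)
  also have "\<dots> \<le> (\<Sum>(A, B)\<in>I. (1 - 1 / real q ^ h) ^ (n - h) * card ?\<Omega>) +
      (\<Sum>s=1..M. \<Sum>(S, F)\<in>J s. card ?\<Omega> / real q ^ (c * s))"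
  proof (intro add_mono sum_mono)
    fix x assume "x \<in> I"
    then show "(case x of (A, B) \<Rightarrow> real (card (bad_extension n q A B))) \<le>
        (case x of (A, B) \<Rightarrow> (1 - 1 / real q ^ h) ^ (n - h) * card ?\<Omega>)"
      using card_bad_extension_le[OF q, of "fst x" n "snd x"] by (auto simp: I_def)
  next
    fix s x assume "x \<in> J s"
    then show "(case x of (S, F) \<Rightarrow> real (card (mono F))) \<le>
        (case x of (S, F) \<Rightarrow> card ?\<Omega> / real q ^ (c * s))"
      using card_monochromatic[of "snd x" n q] q by (auto simp: J_def mono_def)
  qed
  also have "\<dots> = (card I * (1 - 1 / real q ^ h) ^ (n - h) +
      (\<Sum>s=1..M. card (J s) / real q ^ (c * s))) * card ?\<Omega>"
    by (simp add: distrib_right sum_distrib_right)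
  also have "\<dots> \<le> (real n ^ h * 2 ^ h * (1 - 1 / real q ^ h) ^ (n - h) +
      (\<Sum>s=1..M. real n ^ s * 2 ^ (s * s) / real q ^ (c * s))) * card ?\<Omega>"
  proof (intro mult_right_mono add_mono sum_mono divide_right_mono)
    show "real (card I) \<le> real n ^ h * 2 ^ h"
      using cardI by (simp flip: of_nat_le_iff[where 'a = real])
    show "real (card (J s)) \<le> real n ^ s * 2 ^ (s * s)" for s
      using cardJ[of s] by (simp flip: of_nat_le_iff[where 'a = real])
    show "0 \<le> (1 - 1 / real q ^ h) ^ (n - h)"
      using q by (simp add: field_simps)
  qed (use q in auto)
  also have "\<dots> < card ?\<Omega>" using small pos by simp
  finally have "card ?bad < card ?\<Omega>" by simp
  moreover have "finite ?bad"
    using finI finJ fin\<Omega> by (auto simp: bad_extension_def mono_def)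
  ultimately obtain \<chi> where \<chi>: "\<chi> \<in> ?\<Omega>" "\<chi> \<notin> ?bad"
    using card_mono[of ?bad ?\<Omega>] by (meson leD subsetI)
  show ?thesis
  proof (intro exI[of _ \<chi>] conjI allI impI)
    fix A B assume "A \<subseteq> {..<n}" "card A = h" "B \<subseteq> A"
    then have "(A, B) \<in> I" by (simp add: I_def)
    then have "\<chi> \<notin> bad_extension n q A B" using \<chi>(2) by blast
    then show "\<exists>v\<in>{..<n} - A. \<forall>a\<in>A. \<chi> (upair v a) = 0 \<longleftrightarrow> a \<in> B"
      using \<chi>(1) unfolding bad_extension_def mem_Collect_eq by simp
  next
    fix S assume S: "S \<subseteq> {..<n}" "S \<noteq> {}" "card S \<le> M"
    let ?R = "{e \<in> pairs n \<inter> S \<times> S. \<chi> e = 0}"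
    \<comment> \<open>Nonemptiness of \<open>S\<close> puts its size into the range of the sum,
      which starts at \<open>1\<close>.\<close>
    have "card S \<in> {1..M}"
      using S finite_subset[OF S(1)] by (simp add: Suc_le_eq card_gt_0_iff)
    show "card ?R < c * card S"
    proof (rule ccontr)
      assume "\<not> ?thesis"
      then obtain F where F: "F \<subseteq> ?R" "card F = c * card S"
        using obtain_subset_with_card_n[of "c * card S" ?R] by auto
      then have "(S, F) \<in> J (card S)" "\<chi> \<in> mono F" using S(1) \<chi>(1) by (auto simp: J_def mono_def)
      then show False using \<chi>(2) \<open>card S \<in> {1..M}\<close> by blast
    qed
  qed
qed

text \<open>Take \<open>n = q ^ (h + 1)\<close> vertices. A pattern over \<open>h\<close> points has
  about \<open>n / q ^ h = q\<close> expected witnesses and is missed with probability about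
  \<open>exp (- q)\<close>, which beats the polynomial number of patterns. In the sum,
  \<open>n ^ s / q ^ ((h + 2) * s) = 1 / q ^ s\<close>, so it vanishes too.\<close>

lemma exists_edge_density:
  obtains q :: nat where "q \<ge> 2" "q ^ (h + 1) \<ge> h + 1"
    "real (q ^ (h + 1)) ^ h * 2 ^ h * (1 - 1 / real q ^ h) ^ (q ^ (h + 1) - h) +
      (\<Sum>s=1..M. real (q ^ (h + 1)) ^ s * 2 ^ (s * s) / real q ^ ((h + 2) * s)) < 1"
proof -
  \<comment> \<open>The factor \<open>exp (real h)\<close> pays for the \<open>h\<close> vertices
    missing from the exponent; \<open>?K\<close> bounds \<open>M\<close> summands by the largest
    coefficient.\<close>
  let ?C = "2 ^ h * exp (real h)" and ?K = "real M * 2 ^ (M * M)"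
  have "((\<lambda>q. real q ^ ((h + 1) * h) / exp (real q)) \<longlongrightarrow> 0) sequentially"
    using tendsto_power_div_exp_0 filterlim_real_sequentially by (rule filterlim_compose)
  then have "((\<lambda>q. ?C * (real q ^ ((h + 1) * h) / exp (real q))) \<longlongrightarrow> ?C * 0) sequentially"
    by (rule tendsto_mult_left)
  then have "\<forall>\<^sub>F q in sequentially. ?C * (real q ^ ((h + 1) * h) / exp (real q)) < 1 / 2"
    by (rule order_tendstoD) simp
  moreover have "((\<lambda>q. ?K * (1 / real q)) \<longlongrightarrow> ?K * 0) sequentially"
    by (intro tendsto_mult_left lim_1_over_n)
  then have "\<forall>\<^sub>F q in sequentially. ?K * (1 / real q) < 1 / 2"
    by (rule order_tendstoD) simp
  moreover have "\<forall>\<^sub>F q in sequentially. q \<ge> (2::nat)" by (rule eventually_ge_at_top)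
  ultimately have "\<forall>\<^sub>F q in sequentially. q \<ge> 2 \<and>
      ?C * (real q ^ ((h + 1) * h) / exp (real q)) < 1 / 2 \<and> ?K * (1 / real q) < 1 / 2"
    by eventually_elim blast
  then obtain q :: nat where q: "q \<ge> 2"
    and 1: "?C * (real q ^ ((h + 1) * h) / exp (real q)) < 1 / 2" and 2: "?K * (1 / real q) < 1 / 2"
    by (auto simp: eventually_sequentially)
  have "h + 1 < 2 ^ (h + 1)" by (rule less_exp)
  also have "(2::nat) ^ (h + 1) \<le> q ^ (h + 1)" using q by (rule power_mono) simp
  finally have h: "h + 1 \<le> q ^ (h + 1)" by simp
  \<comment> \<open>This is \<open>1 - x \<le> exp (- x)\<close> at
    \<open>x = 1 / q ^ h\<close>.\<close>
  have "(1 - 1 / real q ^ h) ^ (q ^ (h + 1) - h) \<le> exp (- 1 / real q ^ h) ^ (q ^ (h + 1) - h)"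
    using q exp_ge_add_one_self[of "- 1 / real q ^ h"] by (intro power_mono) (simp_all add: field_simps)
  also have "\<dots> = exp (real (q ^ (h + 1) - h) * (- 1 / real q ^ h))"
    by (rule exp_of_nat_mult[symmetric])
  also have "\<dots> = exp (real h / real q ^ h - real q)"
    using h q by (simp add: of_nat_diff field_simps)
  also have "\<dots> \<le> exp (real h - real q)"
    using q mult_left_mono[of 1 "real q ^ h" "real h"] by (simp add: divide_le_eq)
  finally have exp: "(1 - 1 / real q ^ h) ^ (q ^ (h + 1) - h) \<le> exp (real h) / exp (real q)"
    by (simp add: exp_diff)
  have "real (q ^ (h + 1)) ^ h * 2 ^ h * (1 - 1 / real q ^ h) ^ (q ^ (h + 1) - h)
      \<le> real (q ^ (h + 1)) ^ h * 2 ^ h * (exp (real h) / exp (real q))"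
    by (intro mult_left_mono exp) simp
  also have "\<dots> = ?C * (real q ^ ((h + 1) * h) / exp (real q))"
  proof -
    have "real (q ^ (h + 1)) ^ h = real q ^ ((h + 1) * h)"
      by (simp only: of_nat_power power_mult)
    then show ?thesis by simp
  qed
  finally have first: "real (q ^ (h + 1)) ^ h * 2 ^ h * (1 - 1 / real q ^ h) ^ (q ^ (h + 1) - h) < 1 / 2"
    using 1 by (rule order.strict_trans1)
  have "(\<Sum>s=1..M. real (q ^ (h + 1)) ^ s * 2 ^ (s * s) / real q ^ ((h + 2) * s))
      \<le> (\<Sum>s=1..M. 2 ^ (M * M) * (1 / real q))"
  proof (rule sum_mono)
    fix s assume s: "s \<in> {1..M}"
    have "(h + 2) * s = (h + 1) * s + s" by simp
    then have "real q ^ ((h + 2) * s) = real (q ^ (h + 1)) ^ s * real q ^ s"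
    proof -
      have "real q ^ ((h + 2) * s) = real q ^ ((h + 1) * s) * real q ^ s"
        unfolding \<open>(h + 2) * s = (h + 1) * s + s\<close> by (rule power_add)
      then show ?thesis by (simp only: of_nat_power power_mult)
    qed
    then have "real (q ^ (h + 1)) ^ s * 2 ^ (s * s) / real q ^ ((h + 2) * s) = 2 ^ (s * s) * (1 / real q ^ s)"
      using q by simp
    also have "\<dots> \<le> 2 ^ (M * M) * (1 / real q)"
    proof (rule mult_mono)
      show "(2::real) ^ (s * s) \<le> 2 ^ (M * M)" using s by (intro power_increasing mult_mono) auto
      have "real q ^ 1 \<le> real q ^ s" using s q by (intro power_increasing) auto
      then show "1 / real q ^ s \<le> 1 / real q" using q by (simp add: frac_le)
    qed auto
    finally show "real (q ^ (h + 1)) ^ s * 2 ^ (s * s) / real q ^ ((h + 2) * s) \<le> 2 ^ (M * M) * (1 / real q)" .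
  qed
  also have "\<dots> = ?K * (1 / real q)" by simp
  also have "\<dots> < 1 / 2" by (fact 2)
  finally show thesis using that[OF q h] first by simp
qed

text \<open>With \<open>h = k - 1\<close> there are fewer than \<open>(k + 1) * card S\<close> edges
  on a small nonempty \<open>S\<close>. Doubling counts arcs, and one further \<open>card S\<close>
  is the margin, which gives \<open>2 * k + 3\<close>.\<close>

lemma exists_extendible_locally_sparse:
  assumes "k \<ge> 1"
  obtains G :: "nat pair_pre_digraph"
  where "fo_graph G" "extendible k G" "card (pverts G) \<ge> k" "locally_sparse (2 * k + 3) M G"
proof -
  define h where "h = k - 1"
  have k: "k = h + 1" using assms by (simp add: h_def)
  obtain q :: nat where q: "q \<ge> 2" "q ^ (h + 1) \<ge> h + 1"
    "real (q ^ (h + 1)) ^ h * 2 ^ h * (1 - 1 / real q ^ h) ^ (q ^ (h + 1) - h) +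
      (\<Sum>s=1..M. real (q ^ (h + 1)) ^ s * 2 ^ (s * s) / real q ^ ((h + 2) * s)) < 1"
    by (rule exists_edge_density)
  define n where "n = q ^ (h + 1)"
  obtain \<chi> :: "nat \<times> nat \<Rightarrow> nat" where
    ext: "\<forall>A B. A \<subseteq> {..<n} \<longrightarrow> card A = h \<longrightarrow> B \<subseteq> A \<longrightarrow>
      (\<exists>v\<in>{..<n} - A. \<forall>a\<in>A. \<chi> (upair v a) = 0 \<longleftrightarrow> a \<in> B)"
    and sparse: "\<forall>S. S \<subseteq> {..<n} \<longrightarrow> S \<noteq> {} \<longrightarrow> card S \<le> M \<longrightarrow>
      card {e \<in> pairs n \<inter> S \<times> S. \<chi> e = 0} < (h + 2) * card S"
    using exists_colouring[OF q(1) q(3)[folded n_def]] by (elim exE conjE) (rule that)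
  let ?G = "colour_graph n \<chi>"
  have n: "n \<ge> k" using q(2) by (simp add: n_def k)
  show thesis
  proof
    show "fo_graph ?G" using n k by (intro fo_graph_colour_graph) simp
    show "card (pverts ?G) \<ge> k" using n by (simp add: colour_graph_def)
    show "extendible k ?G"
      unfolding extendible_def
    proof (intro allI impI)
      fix A B assume AB: "B \<subseteq> A" "A \<subseteq> pverts ?G" "card A < k"
      have "A \<subseteq> {..<n}" using AB(2) by (simp add: colour_graph_def)
      \<comment> \<open>The colouring handles sets of size exactly \<open>h\<close>; a smaller
        \<open>A\<close> is padded with vertices declared non-neighbours.\<close>
      then obtain A' where A': "A \<subseteq> A'" "A' \<subseteq> {..<n}" "card A' = h"
        using exists_subset_between[of A h "{..<n}"] AB(3) n k by auto
      then have "\<exists>v\<in>{..<n} - A'. \<forall>a\<in>A'. \<chi> (upair v a) = 0 \<longleftrightarrow> a \<in> B" using ext AB(1) by simp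
      then obtain v where v: "v \<in> {..<n} - A'" "\<forall>a\<in>A'. \<chi> (upair v a) = 0 \<longleftrightarrow> a \<in> B" by blast
      show "\<exists>v\<in>pverts ?G - A. \<forall>a\<in>A. (v, a) \<in> parcs ?G \<longleftrightarrow> a \<in> B"
      proof (intro bexI[of _ v] ballI)
        show "v \<in> pverts ?G - A" using v(1) A'(1) by (auto simp: colour_graph_def)
        fix a assume "a \<in> A"
        then have "a \<in> A'" "a < n" "v \<noteq> a" "v < n" using A' v(1) by auto
        then show "(v, a) \<in> parcs ?G \<longleftrightarrow> a \<in> B" using v(2) by (simp add: colour_graph_def)
      qed
    qed
    show "locally_sparse (2 * k + 3) M ?G"
      unfolding locally_sparse_def
    proof (intro allI impI)
      fix S assume S: "S \<subseteq> pverts ?G" "card S \<le> M"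
      let ?R = "{e \<in> pairs n \<inter> S \<times> S. \<chi> e = 0}"
      have finR: "finite ?R" using finite_pairs by simp
      \<comment> \<open>Each arc or its reverse is an increasing pair of colour
        \<open>0\<close>.\<close>
      have "parcs ?G \<inter> S \<times> S \<subseteq> ?R \<union> prod.swap ` ?R"
      proof clarify
        fix u v assume "(u, v) \<in> parcs ?G" "u \<in> S" "v \<in> S" "(u, v) \<notin> prod.swap ` ?R"
        then show "(u, v) \<in> pairs n \<inter> S \<times> S \<and> \<chi> (u, v) = 0"
          by (cases "u < v") (auto simp: colour_graph_def pairs_def upair_def image_iff min_def max_def)
      qed
      then have "card (parcs ?G \<inter> S \<times> S) \<le> card (?R \<union> prod.swap ` ?R)"
        using finR by (intro card_mono) auto
      also have "\<dots> \<le> card ?R + card ?R"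
        using card_Un_le[of ?R "prod.swap ` ?R"] card_image_le[OF finR, of prod.swap] by linarith
      also have "\<dots> \<le> 2 * ((h + 2) * card S)"
      proof (cases "S = {}")
        case False
        then have "card ?R < (h + 2) * card S" using sparse S by (simp add: colour_graph_def)
        then show ?thesis by linarith
      qed simp
      finally show "card (parcs ?G \<inter> S \<times> S) + card S \<le> (2 * k + 3) * card S"
        by (simp add: k algebra_simps)
    qed
  qed
qed


section \<open>Undefinability\<close>

text \<open>At \<open>k = 7\<close> this is \<open>17 < 32\<close>; each step adds \<open>2\<close>
  on the left and doubles the right.\<close>

lemma linear_less_power: "k \<ge> 7 \<Longrightarrow> 2 * k + 3 < 2 ^ (k - 2)" for k :: nat
proof (induction k rule: nat_induct_at_least)
  case (Suc k)
  then have "Suc k - 2 = Suc (k - 2)" by simp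
  then show ?case using Suc by simp
qed simp

theorem theorem2p1:
  fixes k k' :: nat
  assumes "k \<ge> 7"
  shows "\<not> (\<exists>\<Phi> \<in> bigvee_L_ex k'. bigvee_sentence \<Phi> \<and>
           (\<forall>G :: nat pair_pre_digraph. fo_graph G \<longrightarrow> (G \<in> U k \<longleftrightarrow> bigvee_models G \<Phi>)))"
proof
  assume "\<exists>\<Phi> \<in> bigvee_L_ex k'. bigvee_sentence \<Phi> \<and>
    (\<forall>G :: nat pair_pre_digraph. fo_graph G \<longrightarrow> (G \<in> U k \<longleftrightarrow> bigvee_models G \<Phi>))"
  then obtain \<Phi> where \<Phi>: "\<Phi> \<in> bigvee_L_ex k'" "bigvee_sentence \<Phi>"
    and char: "\<forall>G :: nat pair_pre_digraph. fo_graph G \<longrightarrow> (G \<in> U k \<longleftrightarrow> bigvee_models G \<Phi>)"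
    by blast
  define c where "c = 2 * k + 3"
  \<comment> \<open>The summand \<open>1\<close> guarantees \<open>2 * c \<le> M\<close> even for
    \<open>k' = 0\<close>, as the closed set around a single vertex has up to \<open>c\<close>
    elements.\<close>
  define K where "K = k' + 1"
  define M where "M = 2 * c * K"
  have k: "1 \<le> k" "2 \<le> k" using assms by auto
  have M: "1 \<le> M" "2 * c * k' \<le> M" "2 * c \<le> M" "c > 0" by (auto simp: M_def K_def c_def)
  obtain G :: "nat pair_pre_digraph" where G: "fo_graph G" "extendible k G" "card (pverts G) \<ge> k"
    "locally_sparse c M G"
    unfolding c_def by (rule exists_extendible_locally_sparse[OF k(1)])
  have "G \<in> U k" using extendible_imp_universal[OF G(2,1)] by (simp add: U_def)
  then have models: "bigvee_models G \<Phi>" using char G(1) by simp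
  obtain x where x: "x \<in> pverts G" using fo_graphD(2)[OF G(1)] by blast
  then have "bigvee_sat G (\<lambda>_. x) \<Phi>" using models by (simp add: bigvee_models_def)
  \<comment> \<open>One true disjunct suffices: a sparse graph satisfying it satisfies the whole
    disjunction.\<close>
  then obtain \<phi> where \<phi>: "\<phi> \<in> \<Phi>" "sat G (\<lambda>_. x) \<phi>"
    unfolding bigvee_sat_def by (elim bexE)
  have \<phi>_L: "\<phi> \<in> L_ex k'" using \<phi>(1) \<Phi>(1) by (auto simp: bigvee_L_ex_def)
  have \<phi>_closed: "free_vars \<phi> = {}" using \<phi>(1) \<Phi>(2) by (auto simp: bigvee_sentence_def)
  have x_G: "{x} \<subseteq> pverts G" and x_M: "card {x} \<le> M" using x M(1) by simp_all
  obtain D where D: "{x} \<subseteq> D" "card D \<le> c * card {x}" "card D \<le> M" "closed_set c M G D"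
    by (rule exists_closed_set[OF G(4) x_G x_M])
  \<comment> \<open>The construction starts from the subgraph of \<open>G\<close> induced on
    \<open>D\<close>, which is sparse because \<open>D\<close> has at most \<open>M\<close>
    vertices.\<close>
  define X where "X = \<lparr>pverts = D, parcs = parcs G \<inter> D \<times> D\<rparr>"
  have DG: "D \<subseteq> pverts G" using D(4) by (simp add: closed_set_def)
  have X: "fo_graph X"
    using D(1) finite_subset[OF DG] fo_graphD[OF G(1)] by (intro fo_graphI) (auto simp: X_def)
  have sparse: "sparse c X"
    unfolding sparse_def
  proof (intro allI impI)
    fix S assume "S \<subseteq> pverts X"
    then have S: "S \<subseteq> D" by (simp add: X_def)
    have "card S \<le> M"
      using card_mono[OF _ S] finite_subset[OF DG fo_graphD(1)[OF G(1)]] D(3) by simp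
    then have "card (parcs G \<inter> S \<times> S) + card S \<le> c * card S"
      using G(4) subset_trans[OF S DG] by (simp add: locally_sparse_def)
    moreover have "parcs X \<inter> S \<times> S = parcs G \<inter> S \<times> S" using S by (auto simp: X_def)
    ultimately show "card (parcs X \<inter> S \<times> S) \<le> c * card S" by simp
  qed
  have emb: "embeds id G D X" by (auto simp: embeds_def X_def)
  have D_M: "2 * card D \<le> M" using D(2) M(3) by simp
  have vars: "(\<lambda>_. x) ` {1..k'} \<subseteq> D" using D(1) by auto
  obtain X' where X': "fo_graph X'" "sparse c X'" "induced_in X X'" "sat X' (id \<circ> (\<lambda>_. x)) \<phi>"
    by (rule sparse_extension_sat[OF G(1,4) M(2,4) \<phi>_L vars D(4) D_M X sparse emb \<phi>(2)])
  have "sat X' \<rho> \<phi>" for \<rho>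
    using X'(4) sat_cong[of \<phi> \<rho> "id \<circ> (\<lambda>_. x)"] by (simp add: \<phi>_closed)
  then have "bigvee_models X' \<Phi>"
    using \<phi>(1) unfolding bigvee_models_def bigvee_sat_def by blast
  then have "k_universal k X'" using char X'(1) by (simp add: U_def)
  \<comment> \<open>\<open>G\<close> itself serves as the extendible graph in which the density
    sentences hold.\<close>
  moreover have "\<not> k_universal k X'"
    using sparse_not_universal[OF k(2) _ X'(2) G(2,1,3)] linear_less_power[OF assms]
    by (simp add: c_def)
  ultimately show False by blast
qed

end
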